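(* Let $G$ be a countably infinite group, let $b:G\to(\mathbb{R},+)$ be a nonzero homomorphism, and let $d:=b^2$. Suppose $x_0\in F^2(G)$, $y_0\in F^3(G)$, and $v:[0,\infty)\to C_r^*(G)$ is a solution of the wave problem on $C_r^*(G)$ associated to the operator $H_d^{\mathcal{D}}$ and $x_0,y_0$. Then, for all $t\ge0$, $v(t)=u(t)$, where $$u(t):=t\cdot S_b(y_0)+\frac{M_t^b(x_0)+M_{-t}^b(x_0)}{2}+\frac{M_t^b(T_b(y_0))-M_{-t}^b(T_b(y_0))}{2i}.$$
   Context: $\lambda$ is the left regular representation of $G$ on $\ell^2(G)$, $(\lambda(g)\xi)(h)=\xi(g^{-1}h)$; $\{\delta_h\}_{h\in G}$ is the canonical basis of $\ell^2(G)$ and $e$ is the identity of $G$. $C_r^*(G)$ is the closure of $\mathrm{Span}(\lambda(G))$ in $B(\ell^2(G))$ for the operator norm $\|\cdot\|$. For $x\in C_r^*(G)$, the Fourier transform is $\widehat{x}:=x\delta_e\in\ell^2(G)$, with Fourier coefficients $\widehat{x}(g)$, $g\in G$. A series $\sum_{s\in S}x_s$ in a normed space converges to $x$ if the net of its finite partial sums, indexed by the finite subsets of $S$ directed by inclusion, converges to $x$ (unordered convergence). All series below are understood in this sense with respect to $\|\cdot\|$. $CF(G)$ is the set of $x\in C_r^*(G)$ for which $\sum_{g\in G}\widehat{x}(g)\lambda(g)$ is convergent w.r.t. $\|\cdot\|$ (the sum is then necessarily $x$). $\{M_t^b\}_{t\in\mathbb{R}}$ is the one-parameter group of $*$-automorphisms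 of $C_r^*(G)$ with $M_t^b(\lambda(g))=e^{itb(g)}\lambda(g)$ for all $g\in G$, $t\in\mathbb{R}$; the map $t\mapsto M_t^b(x)$ is norm-continuous for every $x\in C_r^*(G)$. Let $\mathcal{C}=\{x\in C_r^*(G):\lim_{t\to0}\frac{M_t^b(x)-x}{t}\text{ exists in }C_r^*(G)\}$, and let $\delta_b^{\mathcal{C}}:\mathcal{C}\to C_r^*(G)$, $\delta_b^{\mathcal{C}}(x)=\lim_{t\to0}\frac{M_t^b(x)-x}{t}$, be the infinitesimal generator. For $n\in\mathbb{N}=\{1,2,\dots\}$, $F^n(G)$ is the set of $x\in C_r^*(G)$ such that, for every $k=0,1,\dots,n$, both $\sum_{g\in G}b(g)^k\widehat{x}(g)\lambda(g)$ and $\sum_{g\notin\ker(b)}b(g)^{-k}\widehat{x}(g)\lambda(g)$ are convergent w.r.t. $\|\cdot\|$ (with $b(g)^0=1$ for all $g$). $T_b:F^1(G)\to C_r^*(G)$ is $T_b(x)=\sum_{g\notin\ker(b)}b(g)^{-1}\widehat{x}(g)\lambda(g)$. $S_b:CF(G)\to C_r^*(G)$ is $S_b(x)=\sum_{g\in\ker(b)}\widehat{x}(g)\lambda(g)$. $\mathcal{D}:=F^2(G)$ and $H_d^{\mathcal{D}}:=\delta_b^{\mathcal{C}}\circ\delta_b^{\mathcal{C}}:\mathcal{D}\to C_r^*(G)$ (the composition is well-defined, since $F^1(G)\subseteq\mathcal{C}$ and $\delta_b^{\mathcal{C}}(F^2(G))\subseteq F^1(G)$). A function $v:[0,\infty)\to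 C_r^*(G)$ is a solution of the wave problem on $C_r^*(G)$ associated to $H_d^{\mathcal{D}}$ and $x_0,y_0\in C_r^*(G)$ if: $v(0)=x_0$; $v(t)\in\mathcal{D}$ for every $t>0$; $v$ is twice differentiable on $(0,\infty)$ (derivatives being limits in the operator norm) and $v''(t)=H_d^{\mathcal{D}}(v(t))$ for every $t>0$; $\lim_{t\to0^+}\|v(t)-x_0\|=0$; and $\lim_{t\to0^+}\|v'(t)-y_0\|=0$. *)

theory Defs
  imports "HOL-Analysis.Analysis"
begin

section \<open>The Hilbert space of square-summable functions\<close>

typedef 'g ell2 = "{f :: 'g \<Rightarrow> complex. (\<lambda>h. (cmod (f h))\<^sup>2) summable_on UNIV}"
  morphisms ell2_apply Abs_ell2
  by (rule exI[of _ "\<lambda>_. 0"]) simp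

setup_lifting type_definition_ell2

lemma ell2_apply_summable: "(\<lambda>h. (cmod (ell2_apply f h))\<^sup>2) summable_on UNIV"
  using ell2_apply by blast

lemma ell2_eqI: "(\<And>h. ell2_apply f h = ell2_apply g h) \<Longrightarrow> f = g"
  using ell2_apply_inject by blast

lemma summable_add_square:
  fixes f g :: "'g \<Rightarrow> complex"
  assumes "(\<lambda>h. (cmod (f h))\<^sup>2) summable_on UNIV" "(\<lambda>h. (cmod (g h))\<^sup>2) summable_on UNIV"
  shows "(\<lambda>h. (cmod (f h + g h))\<^sup>2) summable_on UNIV"
proof (rule summable_on_comparison_test)
  show "(\<lambda>h. 2 * (cmod (f h))\<^sup>2 + 2 * (cmod (g h))\<^sup>2) summable_on UNIV"
    by (intro summable_on_add summable_on_cmult_right assms)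
  show "(cmod (f h + g h))\<^sup>2 \<le> 2 * (cmod (f h))\<^sup>2 + 2 * (cmod (g h))\<^sup>2" for h
  proof -
    have "(cmod (f h + g h))\<^sup>2 \<le> (cmod (f h) + cmod (g h))\<^sup>2"
      by (intro power_mono norm_triangle_ineq) auto
    also have "\<dots> \<le> 2 * (cmod (f h))\<^sup>2 + 2 * (cmod (g h))\<^sup>2"
      using sum_squares_bound[of "cmod (f h)" "cmod (g h)"] by (simp add: power2_sum)
    finally show ?thesis .
  qed
qed simp

lemma summable_scale_square:
  fixes f :: "'g \<Rightarrow> complex"
  assumes "(\<lambda>h. (cmod (f h))\<^sup>2) summable_on UNIV"
  shows "(\<lambda>h. (cmod (c * f h))\<^sup>2) summable_on UNIV"
  using summable_on_cmult_right[OF assms, of "(cmod c)\<^sup>2"] by (simp add: norm_mult power_mult_distrib)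

lift_definition ell2_scale :: "complex \<Rightarrow> 'g ell2 \<Rightarrow> 'g ell2" is "\<lambda>c f h. c * f h"
  by (auto intro: summable_scale_square)

lemma ell2_inner_summable:
  "(\<lambda>h. ell2_apply f h \<bullet> ell2_apply g h) summable_on UNIV"
proof (rule Infinite_Sum.abs_summable_summable, rule Infinite_Sum.abs_summable_on_comparison_test')
  show "(\<lambda>h. (cmod (ell2_apply f h))\<^sup>2 + (cmod (ell2_apply g h))\<^sup>2) summable_on UNIV"
    by (intro summable_on_add ell2_apply_summable)
  show "norm (ell2_apply f h \<bullet> ell2_apply g h)
      \<le> (cmod (ell2_apply f h))\<^sup>2 + (cmod (ell2_apply g h))\<^sup>2" for h
  proof -
    have "norm (ell2_apply f h \<bullet> ell2_apply g h) \<le> cmod (ell2_apply f h) * cmod (ell2_apply g h)"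
      by (simp add: Cauchy_Schwarz_ineq2)
    also have "\<dots> \<le> (cmod (ell2_apply f h))\<^sup>2 + (cmod (ell2_apply g h))\<^sup>2"
      using sum_squares_bound[of "cmod (ell2_apply f h)" "cmod (ell2_apply g h)"]
        mult_nonneg_nonneg[OF norm_ge_zero norm_ge_zero, of "ell2_apply f h" "ell2_apply g h"]
      by linarith
    finally show ?thesis .
  qed
qed

instantiation ell2 :: (type) real_inner
begin

lift_definition zero_ell2 :: "'a ell2" is "\<lambda>_. 0" by simp
lift_definition plus_ell2 :: "'a ell2 \<Rightarrow> 'a ell2 \<Rightarrow> 'a ell2" is "\<lambda>f g h. f h + g h"
  by (auto intro: summable_add_square)
lift_definition uminus_ell2 :: "'a ell2 \<Rightarrow> 'a ell2" is "\<lambda>f h. - f h" by simp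
lift_definition minus_ell2 :: "'a ell2 \<Rightarrow> 'a ell2 \<Rightarrow> 'a ell2" is "\<lambda>f g h. f h - g h"
  using summable_add_square[of _ "\<lambda>h. - _ h"] by simp
lift_definition scaleR_ell2 :: "real \<Rightarrow> 'a ell2 \<Rightarrow> 'a ell2" is "\<lambda>r f h. r *\<^sub>R f h"
  by (auto simp: scaleR_conv_of_real intro!: summable_scale_square)

text \<open>
  This is the real part of the complex inner product \<open>ell2_cinner\<close> defined below;
  both induce the norm of the space.
\<close>
definition inner_ell2 :: "'a ell2 \<Rightarrow> 'a ell2 \<Rightarrow> real" where
  "inner_ell2 f g = (\<Sum>\<^sub>\<infinity>h. ell2_apply f h \<bullet> ell2_apply g h)"
definition norm_ell2 :: "'a ell2 \<Rightarrow> real" where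
  "norm_ell2 f = sqrt (\<Sum>\<^sub>\<infinity>h. (cmod (ell2_apply f h))\<^sup>2)"
definition sgn_ell2 :: "'a ell2 \<Rightarrow> 'a ell2" where
  "sgn_ell2 f = inverse (norm f) *\<^sub>R f"
definition dist_ell2 :: "'a ell2 \<Rightarrow> 'a ell2 \<Rightarrow> real" where
  "dist_ell2 f g = norm (f - g)"
definition uniformity_ell2 :: "('a ell2 \<times> 'a ell2) filter" where
  "uniformity_ell2 = (INF e\<in>{0<..}. principal {(f, g). dist f g < e})"
definition open_ell2 :: "'a ell2 set \<Rightarrow> bool" where
  "open_ell2 U = (\<forall>x\<in>U. eventually (\<lambda>(x', y). x' = x \<longrightarrow> y \<in> U) uniformity)"

instance
proof
  fix f g k :: "'a ell2" and r s :: real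
  show "f + g + k = f + (g + k)" "f + g = g + f" "0 + f = f" "- f + f = 0" "f - g = f + - g"
    by (transfer; simp add: fun_eq_iff)+
  show "r *\<^sub>R (f + g) = r *\<^sub>R f + r *\<^sub>R g" "(r + s) *\<^sub>R f = r *\<^sub>R f + s *\<^sub>R f"
      "r *\<^sub>R s *\<^sub>R f = (r * s) *\<^sub>R f" "1 *\<^sub>R f = f"
    by (transfer; simp add: fun_eq_iff algebra_simps)+
  show "dist f g = norm (f - g)" by (fact dist_ell2_def)
  show "sgn f = inverse (norm f) *\<^sub>R f" by (fact sgn_ell2_def)
  show "uniformity = (INF e\<in>{0<..}. principal {(f, g :: 'a ell2). dist f g < e})"
    by (fact uniformity_ell2_def)
  show "open U = (\<forall>x\<in>U. \<forall>\<^sub>F (x', y) in uniformity. x' = x \<longrightarrow> y \<in> U)" for U :: "'a ell2 set"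
    by (fact open_ell2_def)
  show "f \<bullet> g = g \<bullet> f"
    by (simp add: inner_ell2_def inner_commute)
  show "(f + g) \<bullet> k = f \<bullet> k + g \<bullet> k"
    by (simp add: inner_ell2_def plus_ell2.rep_eq inner_add_left infsum_add ell2_inner_summable)
  show "(r *\<^sub>R f) \<bullet> g = r * (f \<bullet> g)"
    by (simp add: inner_ell2_def scaleR_ell2.rep_eq infsum_cmult_right')
  show "0 \<le> f \<bullet> f"
    by (simp add: inner_ell2_def infsum_nonneg)
  show "f \<bullet> f = 0 \<longleftrightarrow> f = 0"
  proof
    assume "f \<bullet> f = 0"
    then have "(\<Sum>\<^sub>\<infinity>h. ell2_apply f h \<bullet> ell2_apply f h) \<le> 0"
      unfolding inner_ell2_def by (rule eq_refl)
    then have "ell2_apply f h \<bullet> ell2_apply f h = 0" for h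
      by (rule nonneg_infsum_le_0D) (simp_all add: ell2_inner_summable)
    then show "f = 0"
      by (intro ell2_eqI) (simp add: zero_ell2.rep_eq)
  qed (simp add: inner_ell2_def zero_ell2.rep_eq)
  show "norm f = sqrt (f \<bullet> f)"
    by (simp add: norm_ell2_def inner_ell2_def power2_norm_eq_inner)
qed

end

definition ell2_cinner :: "'g ell2 \<Rightarrow> 'g ell2 \<Rightarrow> complex" where
  "ell2_cinner f g = (\<Sum>\<^sub>\<infinity>h. ell2_apply f h * cnj (ell2_apply g h))"

lift_definition ell2_delta :: "'g \<Rightarrow> 'g ell2" is "\<lambda>h k. if k = h then 1 else 0"
  by (rule finite_nonzero_values_imp_summable_on) (auto simp: if_distrib cong: if_cong)

lemma norm_ell2_scale: "norm (ell2_scale c f) = cmod c * norm f"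
  by (simp add: norm_ell2_def ell2_scale.rep_eq norm_mult power_mult_distrib
      infsum_cmult_right' real_sqrt_mult)

lemma bounded_linear_ell2_scale: "bounded_linear (ell2_scale c)"
  by (rule bounded_linear_intro[where K = "cmod c"])
    (auto simp: norm_ell2_scale ell2_scale.rep_eq plus_ell2.rep_eq scaleR_ell2.rep_eq
      algebra_simps intro!: ell2_eqI)

section \<open>Bounded operators\<close>

text \<open>
  Operators on \<open>\<ell>\<^sup>2\<close> are elements of \<open>'g ell2 \<Rightarrow>\<^sub>L 'g ell2\<close>, whose norm is the operator norm.
  This type also contains operators that are only real-linear; the reduced group
  C*-algebra defined below is a set of complex-linear ones.
\<close>

type_synonym 'g oper = "'g ell2 \<Rightarrow>\<^sub>L 'g ell2"

definition oper_scale :: "complex \<Rightarrow> 'g oper \<Rightarrow> 'g oper" (infixr \<open>*\<^sub>C\<close> 75) where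
  "c *\<^sub>C T = Blinfun (\<lambda>f. ell2_scale c (blinfun_apply T f))"

lemma oper_scale_apply: "blinfun_apply (c *\<^sub>C T) f = ell2_scale c (blinfun_apply T f)"
  unfolding oper_scale_def
  by (simp add: bounded_linear_Blinfun_apply
      bounded_linear_compose[OF bounded_linear_ell2_scale blinfun.bounded_linear_right])

interpretation oper: vector_space "oper_scale :: complex \<Rightarrow> 'g oper \<Rightarrow> 'g oper"
  by unfold_locales
    (auto intro!: blinfun_eqI ell2_eqI simp: oper_scale_apply blinfun.add_left ell2_scale.rep_eq
      plus_ell2.rep_eq algebra_simps)

definition oper_adj :: "'g oper \<Rightarrow> 'g oper" where
  "oper_adj T = (THE S. \<forall>f g. ell2_cinner (blinfun_apply S f) g = ell2_cinner f (blinfun_apply T g))"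

section \<open>The reduced group C*-algebra\<close>

text \<open>
  A group is a type of class \<open>group_add\<close>: the group law is written additively but is not
  assumed to be commutative, so \<open>- g + h\<close> is \<open>g\<^sup>-\<^sup>1h\<close> and \<open>0\<close> is the identity.
\<close>

lemma bij_left_translation: "bij_betw (\<lambda>h. - g + h) UNIV (UNIV :: 'g::group_add set)"
  by (rule bij_betw_byWitness[where f' = "\<lambda>h. g + h"]) (auto simp: add.assoc[symmetric])

lift_definition ell2_translate :: "'g::group_add \<Rightarrow> 'g ell2 \<Rightarrow> 'g ell2" is "\<lambda>g f h. f (- g + h)"
  by (subst summable_on_reindex_bij_betw[OF bij_left_translation, of "\<lambda>h. (cmod (_ h))\<^sup>2"])

lemma norm_ell2_translate: "norm (ell2_translate g f) = norm f"
  using infsum_reindex_bij_betw[OF bij_left_translation, of "\<lambda>h. (cmod (ell2_apply f h))\<^sup>2" g]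
  by (simp add: norm_ell2_def ell2_translate.rep_eq)

lemma bounded_linear_ell2_translate: "bounded_linear (ell2_translate g)"
  by (rule bounded_linear_intro[where K = 1])
    (auto simp: norm_ell2_translate ell2_translate.rep_eq plus_ell2.rep_eq scaleR_ell2.rep_eq
      intro!: ell2_eqI)

definition lreg :: "'g::group_add \<Rightarrow> 'g oper" where
  "lreg g = Blinfun (ell2_translate g)"

lemma lreg_apply: "blinfun_apply (lreg g) f = ell2_translate g f"
  by (simp add: lreg_def bounded_linear_Blinfun_apply bounded_linear_ell2_translate)

definition Cred :: "'g::group_add oper set" where
  "Cred = closure (oper.span (range lreg))"

definition fourier :: "'g::group_add oper \<Rightarrow> 'g \<Rightarrow> complex" where
  "fourier x = ell2_apply (blinfun_apply x (ell2_delta 0))"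

text \<open>
  Unordered series in the operator norm are expressed by \<open>summable_on\<close> and \<open>infsum\<close> in the
  type of bounded operators. Their sums lie in the closed set \<open>Cred\<close>, so no separate
  convergence inside \<open>Cred\<close> is needed.
\<close>

section \<open>The modulation group and its generator\<close>

definition Cred_star_automorphism :: "('g::group_add oper \<Rightarrow> 'g oper) \<Rightarrow> bool" where
  "Cred_star_automorphism \<Phi> \<longleftrightarrow>
     bij_betw \<Phi> Cred Cred \<and>
     (\<forall>x\<in>Cred. \<forall>y\<in>Cred. \<Phi> (x + y) = \<Phi> x + \<Phi> y) \<and>
     (\<forall>c. \<forall>x\<in>Cred. \<Phi> (c *\<^sub>C x) = c *\<^sub>C \<Phi> x) \<and>
     (\<forall>x\<in>Cred. \<forall>y\<in>Cred. \<Phi> (x o\<^sub>L y) = \<Phi> x o\<^sub>L \<Phi> y) \<and>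
     (\<forall>x\<in>Cred. \<Phi> (oper_adj x) = oper_adj (\<Phi> x))"

text \<open>
  These properties determine \<open>M t\<close> on \<open>Cred\<close>: *-automorphisms are isometric and the span
  of the translations is dense. Norm continuity of \<open>t \<mapsto> M t x\<close> follows, so it is not part
  of the definition.
\<close>
definition modulation_group :: "('g::group_add \<Rightarrow> real) \<Rightarrow> (real \<Rightarrow> 'g oper \<Rightarrow> 'g oper) \<Rightarrow> bool" where
  "modulation_group b M \<longleftrightarrow>
     (\<forall>t. Cred_star_automorphism (M t)) \<and>
     (\<forall>x\<in>Cred. M 0 x = x) \<and>
     (\<forall>s t. \<forall>x\<in>Cred. M (s + t) x = M s (M t x)) \<and>
     (\<forall>t g. M t (lreg g) = exp (\<i> * t * b g) *\<^sub>C lreg g)"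

definition gen_dom :: "(real \<Rightarrow> 'g::group_add oper \<Rightarrow> 'g oper) \<Rightarrow> 'g oper set" where
  "gen_dom M = {x \<in> Cred. \<exists>y\<in>Cred. ((\<lambda>t. (M t x - x) /\<^sub>R t) \<longlongrightarrow> y) (at 0)}"

text \<open>Only meaningful on \<open>gen_dom M\<close>; elsewhere the value is unspecified.\<close>
definition gen :: "(real \<Rightarrow> 'g::group_add oper \<Rightarrow> 'g oper) \<Rightarrow> 'g oper \<Rightarrow> 'g oper" where
  "gen M x = Lim (at 0) (\<lambda>t. (M t x - x) /\<^sub>R t)"

section \<open>Smoothness classes and the wave problem\<close>

definition CF :: "'g::group_add oper set" where
  "CF = {x \<in> Cred. (\<lambda>g. fourier x g *\<^sub>C lreg g) summable_on UNIV}"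

definition hom_ker :: "('g::group_add \<Rightarrow> real) \<Rightarrow> 'g set" where
  "hom_ker b = {g. b g = 0}"

definition Fsmooth :: "nat \<Rightarrow> ('g::group_add \<Rightarrow> real) \<Rightarrow> 'g oper set" where
  "Fsmooth n b = {x \<in> Cred. \<forall>k\<le>n.
     (\<lambda>g. (of_real (b g ^ k) * fourier x g) *\<^sub>C lreg g) summable_on UNIV \<and>
     (\<lambda>g. (of_real (inverse (b g ^ k)) * fourier x g) *\<^sub>C lreg g) summable_on (- hom_ker b)}"

text \<open>The operator \<open>T_op b\<close> is used on \<open>Fsmooth 1 b\<close>, and \<open>S_op b\<close> on \<open>CF\<close>.\<close>
definition T_op :: "('g::group_add \<Rightarrow> real) \<Rightarrow> 'g oper \<Rightarrow> 'g oper" where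
  "T_op b x = (\<Sum>\<^sub>\<infinity>g\<in>- hom_ker b. (of_real (inverse (b g)) * fourier x g) *\<^sub>C lreg g)"

definition S_op :: "('g::group_add \<Rightarrow> real) \<Rightarrow> 'g oper \<Rightarrow> 'g oper" where
  "S_op b x = (\<Sum>\<^sub>\<infinity>g\<in>hom_ker b. fourier x g *\<^sub>C lreg g)"

text \<open>The operator associated with \<open>d = b\<^sup>2\<close>, used on its domain \<open>Fsmooth 2 b\<close>.\<close>
definition H_op :: "(real \<Rightarrow> 'g::group_add oper \<Rightarrow> 'g oper) \<Rightarrow> 'g oper \<Rightarrow> 'g oper" where
  "H_op M x = gen M (gen M x)"

text \<open>
  A function on \<open>[0, \<infinity>)\<close> is a function on \<open>real\<close> of which only the values at \<open>t \<ge> 0\<close>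
  matter; \<open>v'\<close> is determined on \<open>(0, \<infinity>)\<close> as the derivative of \<open>v\<close>.
\<close>
definition wave_solution ::
  "('g::group_add \<Rightarrow> real) \<Rightarrow> (real \<Rightarrow> 'g oper \<Rightarrow> 'g oper) \<Rightarrow> 'g oper \<Rightarrow> 'g oper \<Rightarrow> (real \<Rightarrow> 'g oper) \<Rightarrow> bool"
where
  "wave_solution b M x0 y0 v \<longleftrightarrow>
     (\<forall>t\<ge>0. v t \<in> Cred) \<and> v 0 = x0 \<and> (\<forall>t>0. v t \<in> Fsmooth 2 b) \<and>
     (\<exists>v'. (\<forall>t>0. (v has_vector_derivative v' t) (at t)) \<and>
           (\<forall>t>0. (v' has_vector_derivative H_op M (v t)) (at t)) \<and>
           ((\<lambda>t. norm (v t - x0)) \<longlongrightarrow> 0) (at_right 0) \<and>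
           ((\<lambda>t. norm (v' t - y0)) \<longlongrightarrow> 0) (at_right 0))"

end

theory Submission
  imports Defs
begin

text \<open>
  An element of the reduced group C*-algebra is determined by its Fourier coefficients
  (\<open>Cred_eqI_fourier\<close>), so it suffices to identify those of \<open>v t\<close>. Two applications of the generator
  multiply the coefficient at \<open>g\<close> by \<open>- (b g)\<^sup>2\<close> (\<open>fourier_H_op\<close>). As each coefficient is a bounded
  linear functional, \<open>t \<mapsto> fourier (v t) g\<close> solves the ordinary differential equation
  \<open>f'' = - (b g)\<^sup>2 f\<close> on the positive axis, with initial data \<open>fourier x0 g\<close> and
  \<open>fourier y0 g\<close> attained as limits at \<open>0\<close>. This equation has only one solution
  (\<open>oscillator_solution\<close>): a combination of \<open>cos\<close> and \<open>sin\<close> if \<open>b g \<noteq> 0\<close>, an affine function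
  if \<open>b g = 0\<close>. The coefficients of the proposed solution are the same, because \<open>M t\<close> multiplies the
  coefficient at \<open>g\<close> by \<open>exp (\<i> t b g)\<close> (\<open>fourier_modulation\<close>).

  The last fact is given on translations only. Extending it to the closure requires that \<open>M t\<close> be
  bounded, which has to be extracted from its being a *-automorphism: this is
  automatic continuity (\<open>aut_norm_le\<close>), which rests on square roots of \<open>1 - x\<^sup>* x\<close> inside
  the algebra. These in turn exist because the space of square-summable functions, and with it
  the algebra, is complete.
  Boundedness of the \<open>M t\<close>, uniform in \<open>t\<close>, also gives strong continuity at \<open>0\<close>, and with it the
  explicit form of the generator on elements with convergent differentiated series
  (\<open>generator_tendsto\<close>).
\<close>

section \<open>Square-summable functions form a Hilbert space\<close>

lemma ell2_apply_bounded_linear: "bounded_linear (\<lambda>f. ell2_apply f h)"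
proof (rule bounded_linear_intro[where K = 1])
  fix f :: "'a ell2"
  have "sum (\<lambda>h. (cmod (ell2_apply f h))\<^sup>2) {h} \<le> (\<Sum>\<^sub>\<infinity>h. (cmod (ell2_apply f h))\<^sup>2)"
    by (rule finite_sum_le_infsum) (auto intro: ell2_apply_summable)
  then show "norm (ell2_apply f h) \<le> norm f * 1"
    by (simp add: norm_ell2_def real_le_rsqrt)
qed (auto simp: plus_ell2.rep_eq scaleR_ell2.rep_eq)

lemma finite_sum_cmod2_le_norm2:
  assumes "finite A"
  shows "(\<Sum>h\<in>A. (cmod (ell2_apply f h))\<^sup>2) \<le> (norm f)\<^sup>2"
proof -
  have "(\<Sum>h\<in>A. (cmod (ell2_apply f h))\<^sup>2) \<le> (\<Sum>\<^sub>\<infinity>h. (cmod (ell2_apply f h))\<^sup>2)"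
    by (rule finite_sum_le_infsum) (auto intro: ell2_apply_summable assms)
  then show ?thesis
    by (simp add: norm_ell2_def infsum_nonneg)
qed

lemma ell2_of_bounded_finite_sums:
  fixes F :: "'g \<Rightarrow> complex"
  assumes "\<And>A. finite A \<Longrightarrow> (\<Sum>h\<in>A. (cmod (F h))\<^sup>2) \<le> c\<^sup>2" and "c \<ge> 0"
  obtains f where "ell2_apply f = F" "norm f \<le> c"
proof -
  have "(\<lambda>h. (cmod (F h))\<^sup>2) summable_on UNIV"
    by (rule nonneg_bdd_above_summable_on) (auto intro!: bdd_aboveI2 assms)
  then have F: "ell2_apply (Abs_ell2 F) = F" and "(\<Sum>\<^sub>\<infinity>h. (cmod (F h))\<^sup>2) \<le> c\<^sup>2"
    by (auto simp: Abs_ell2_inverse intro!: infsum_le_finite_sums assms)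
  then have "norm (Abs_ell2 F) \<le> c"
    using assms(2) by (simp add: norm_ell2_def real_le_lsqrt)
  with F show ?thesis by (rule that)
qed

text \<open>
  Completeness is what makes the space of bounded operators a Banach space. The limit of a
  Cauchy sequence is taken pointwise; the tail estimate passes to it on each finite set of
  indices, and from there to the norm.
\<close>
instance ell2 :: (type) banach
proof
  fix X :: "nat \<Rightarrow> 'a ell2"
  assume X: "Cauchy X"
  define F where "F h = lim (\<lambda>n. ell2_apply (X n) h)" for h
  have F: "(\<lambda>n. ell2_apply (X n) h) \<longlonglongrightarrow> F h" for h
    using bounded_linear.Cauchy[OF ell2_apply_bounded_linear X]
    by (simp add: F_def Cauchy_convergent_iff convergent_LIMSEQ_iff)
  have key: "\<exists>N. \<forall>m\<ge>N. \<exists>d. ell2_apply d = (\<lambda>h. ell2_apply (X m) h - F h) \<and> norm d \<le> e"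
    if "e > 0" for e :: real
  proof -
    obtain N where N: "\<And>m n. m \<ge> N \<Longrightarrow> n \<ge> N \<Longrightarrow> norm (X m - X n) < e"
      using X \<open>e > 0\<close> unfolding Cauchy_iff by blast
    have "\<exists>d. ell2_apply d = (\<lambda>h. ell2_apply (X m) h - F h) \<and> norm d \<le> e" if m: "m \<ge> N" for m
    proof -
      have "(\<Sum>h\<in>A. (cmod (ell2_apply (X m) h - F h))\<^sup>2) \<le> e\<^sup>2" if "finite A" for A
      proof (rule tendsto_upperbound)
        show "(\<lambda>n. \<Sum>h\<in>A. (cmod (ell2_apply (X m) h - ell2_apply (X n) h))\<^sup>2)
          \<longlonglongrightarrow> (\<Sum>h\<in>A. (cmod (ell2_apply (X m) h - F h))\<^sup>2)"
          by (intro tendsto_intros F)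
        have "(\<Sum>h\<in>A. (cmod (ell2_apply (X m) h - ell2_apply (X n) h))\<^sup>2) \<le> e\<^sup>2" if "n \<ge> N" for n
        proof -
          have "(\<Sum>h\<in>A. (cmod (ell2_apply (X m) h - ell2_apply (X n) h))\<^sup>2) \<le> (norm (X m - X n))\<^sup>2"
            using finite_sum_cmod2_le_norm2[OF \<open>finite A\<close>, of "X m - X n"]
            by (simp add: minus_ell2.rep_eq)
          also have "\<dots> \<le> e\<^sup>2"
            using N[OF m that] by (intro power_mono) auto
          finally show ?thesis .
        qed
        then show "\<forall>\<^sub>F n in sequentially.
            (\<Sum>h\<in>A. (cmod (ell2_apply (X m) h - ell2_apply (X n) h))\<^sup>2) \<le> e\<^sup>2"
          using eventually_sequentially by blast
      qed simp
      moreover have "e \<ge> 0" using \<open>e > 0\<close> by simp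
      ultimately show ?thesis
        using ell2_of_bounded_finite_sums[of "\<lambda>h. ell2_apply (X m) h - F h" e] by blast
    qed
    then show ?thesis by blast
  qed
  obtain N d where d: "ell2_apply d = (\<lambda>h. ell2_apply (X N) h - F h)"
    using key[of 1] by auto
  define L where "L = X N - d"
  have L: "ell2_apply L h = F h" for h
    by (simp add: L_def minus_ell2.rep_eq d)
  have "X \<longlonglongrightarrow> L"
  proof (rule LIMSEQ_I)
    fix r :: real assume "r > 0"
    then obtain N where N: "\<And>m. m \<ge> N \<Longrightarrow>
        \<exists>d. ell2_apply d = (\<lambda>h. ell2_apply (X m) h - F h) \<and> norm d \<le> r / 2"
      using key[of "r / 2"] by auto
    have "norm (X m - L) < r" if m: "m \<ge> N" for m
    proof -
      obtain d where "ell2_apply d = (\<lambda>h. ell2_apply (X m) h - F h)" "norm d \<le> r / 2"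
        using N[OF m] by blast
      moreover from this have "X m - L = d"
        by (intro ell2_eqI) (simp add: minus_ell2.rep_eq L)
      ultimately show ?thesis using \<open>r > 0\<close> by simp
    qed
    then show "\<exists>no. \<forall>n\<ge>no. norm (X n - L) < r" by blast
  qed
  then show "convergent X" by (rule convergentI)
qed

lemma ell2_scale_scale: "ell2_scale c (ell2_scale d f) = ell2_scale (c * d) f"
  by (rule ell2_eqI) (simp add: ell2_scale.rep_eq)

lemma ell2_scale_add: "ell2_scale c (f + g) = ell2_scale c f + ell2_scale c g"
  by (rule ell2_eqI) (simp add: ell2_scale.rep_eq plus_ell2.rep_eq algebra_simps)

lemma ell2_scale_zero [simp]: "ell2_scale c 0 = 0"
  by (rule ell2_eqI) (simp add: ell2_scale.rep_eq zero_ell2.rep_eq)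

lemma ell2_scale_inner: "ell2_scale c f \<bullet> g = f \<bullet> ell2_scale (cnj c) g"
  unfolding inner_ell2_def
  by (rule infsum_cong) (simp add: ell2_scale.rep_eq inner_complex_def algebra_simps)

lemma inner_ell2_scale_delta: "f \<bullet> ell2_scale c (ell2_delta k) = Re (ell2_apply f k * cnj c)"
proof -
  have "f \<bullet> ell2_scale c (ell2_delta k)
      = (\<Sum>\<^sub>\<infinity>h\<in>{k}. ell2_apply f h \<bullet> ell2_apply (ell2_scale c (ell2_delta k)) h)"
    unfolding inner_ell2_def
    by (rule infsum_cong_neutral) (auto simp: ell2_scale.rep_eq ell2_delta.rep_eq)
  then show ?thesis
    by (simp add: ell2_scale.rep_eq ell2_delta.rep_eq inner_complex_def)
qed

lemma ell2_eq_0_if_orthogonal_deltas: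
  assumes "\<And>c k. f \<bullet> ell2_scale c (ell2_delta k) = 0"
  shows "f = 0"
proof (rule ell2_eqI)
  fix k
  have "Re (ell2_apply f k) = 0" "Im (ell2_apply f k) = 0"
    using assms[of 1 k] assms[of \<i> k] by (simp_all add: inner_ell2_scale_delta)
  then show "ell2_apply f k = ell2_apply 0 k"
    by (simp add: zero_ell2.rep_eq complex_eq_iff)
qed

lemma ell2_cinner_summable: "(\<lambda>h. ell2_apply f h * cnj (ell2_apply g h)) summable_on UNIV"
proof (rule Infinite_Sum.abs_summable_summable, rule Infinite_Sum.abs_summable_on_comparison_test')
  show "(\<lambda>h. (cmod (ell2_apply f h))\<^sup>2 + (cmod (ell2_apply g h))\<^sup>2) summable_on UNIV"
    by (intro summable_on_add ell2_apply_summable)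
  show "norm (ell2_apply f h * cnj (ell2_apply g h))
      \<le> (cmod (ell2_apply f h))\<^sup>2 + (cmod (ell2_apply g h))\<^sup>2" for h
    using sum_squares_bound[of "cmod (ell2_apply f h)" "cmod (ell2_apply g h)"]
      mult_nonneg_nonneg[OF norm_ge_zero norm_ge_zero, of "ell2_apply f h" "ell2_apply g h"]
    unfolding norm_mult complex_mod_cnj by linarith
qed

text \<open>
  The complex inner product is recovered from the real one. Hence the adjoint of a
  complex-linear operator may be computed with the real inner product alone.
\<close>
lemma ell2_cinner_eq: "ell2_cinner f g = Complex (f \<bullet> g) (f \<bullet> ell2_scale \<i> g)"
proof (rule complex_eqI)
  show "Re (ell2_cinner f g) = Re (Complex (f \<bullet> g) (f \<bullet> ell2_scale \<i> g))"
    unfolding ell2_cinner_def infsum_Re[OF ell2_cinner_summable, symmetric]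
    by (simp add: inner_ell2_def inner_complex_def)
  show "Im (ell2_cinner f g) = Im (Complex (f \<bullet> g) (f \<bullet> ell2_scale \<i> g))"
    unfolding ell2_cinner_def infsum_Im[OF ell2_cinner_summable, symmetric]
    by (simp add: inner_ell2_def inner_complex_def ell2_scale.rep_eq algebra_simps)
qed

section \<open>The algebra of the left regular representation\<close>

lemma bounded_linear_oper_scale: "bounded_linear (oper_scale c)"
proof (rule bounded_linear_intro[where K = "cmod c"])
  fix T :: "'g oper"
  have "norm (blinfun_apply (c *\<^sub>C T) f) \<le> (norm T * cmod c) * norm f" for f
    using mult_left_mono[OF norm_blinfun[of T f], of "cmod c"]
    by (simp add: oper_scale_apply norm_ell2_scale algebra_simps)
  then show "norm (c *\<^sub>C T) \<le> norm T * cmod c"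
    by (intro norm_blinfun_bound) auto
qed (auto intro!: blinfun_eqI ell2_eqI simp: oper_scale_apply blinfun.add_left
    blinfun.scaleR_left ell2_scale.rep_eq plus_ell2.rep_eq scaleR_ell2.rep_eq algebra_simps)

lemma oper_scale_of_real: "of_real r *\<^sub>C T = r *\<^sub>R T"
  by (intro blinfun_eqI ell2_eqI)
    (simp add: oper_scale_apply blinfun.scaleR_left ell2_scale.rep_eq scaleR_ell2.rep_eq
      scaleR_conv_of_real)

lemma compose_oper_scale_left: "(c *\<^sub>C S) o\<^sub>L T = c *\<^sub>C (S o\<^sub>L T)"
  by (intro blinfun_eqI) (simp add: oper_scale_apply)

lemma lreg_compose: "lreg g o\<^sub>L lreg h = lreg (g + h)"
  by (intro blinfun_eqI ell2_eqI)
    (simp add: lreg_apply ell2_translate.rep_eq minus_add add.assoc[symmetric])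

lemma lreg_zero: "lreg 0 = id_blinfun"
  by (intro blinfun_eqI ell2_eqI) (simp add: lreg_apply ell2_translate.rep_eq)

lemma ell2_translate_scale: "ell2_translate g (ell2_scale c f) = ell2_scale c (ell2_translate g f)"
  by (rule ell2_eqI) (simp add: ell2_translate.rep_eq ell2_scale.rep_eq)

lemma ell2_translate_inner: "ell2_translate g f \<bullet> k = f \<bullet> ell2_translate (- g) k"
  using infsum_reindex_bij_betw[OF bij_left_translation,
      of "\<lambda>h. ell2_apply f h \<bullet> ell2_apply k (g + h)" g]
  by (simp add: inner_ell2_def ell2_translate.rep_eq add.assoc[symmetric])

lemma closed_Cred: "closed Cred"
  by (simp add: Cred_def)

lemma span_lreg_subset_Cred: "oper.span (range lreg) \<subseteq> Cred"
  by (simp add: Cred_def closure_subset)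

lemma lreg_in_Cred: "lreg g \<in> Cred"
  using span_lreg_subset_Cred oper.span_base by blast

text \<open>
  The induction principle of a closed span: a closed property of operators needs to be checked
  only on finite linear combinations of translations, built up one term at a time.
\<close>
lemma Cred_closed_induct [consumes 1, case_names closed zero lreg]:
  assumes "x \<in> Cred"
    and "closed {x. P x}"
    and "P 0"
    and "\<And>c g y. P y \<Longrightarrow> P (c *\<^sub>C lreg g + y)"
  shows "P x"
proof -
  have "P y" if "y \<in> oper.span (range lreg)" for y
    using that
  proof (induction rule: oper.span_induct_alt)
    case (step c z y)
    then obtain g where "z = lreg g" by blast
    then show ?case using assms(4) step by blast
  qed (rule assms(3))
  then have "closure (oper.span (range lreg)) \<subseteq> {x. P x}"
    by (intro closure_minimal assms(2)) auto
  then show ?thesis using assms(1) by (auto simp: Cred_def)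
qed

lemma Cred_scale:
  assumes "x \<in> Cred"
  shows "c *\<^sub>C x \<in> Cred"
proof -
  have "oper_scale c ` closure (oper.span (range lreg)) \<subseteq> closure (oper.span (range lreg))"
  proof (rule image_closure_subset)
    show "continuous_on (closure (oper.span (range lreg))) (oper_scale c)"
      by (rule linear_continuous_on[OF bounded_linear_oper_scale])
    show "oper_scale c ` oper.span (range lreg) \<subseteq> closure (oper.span (range lreg))"
      using oper.span_scale closure_subset by blast
  qed simp
  then show ?thesis using assms unfolding Cred_def by blast
qed

lemma Cred_add:
  assumes "x \<in> Cred" "y \<in> Cred"
  shows "x + y \<in> Cred"
proof -
  obtain X where X: "\<And>n. X n \<in> oper.span (range lreg)" "X \<longlonglongrightarrow> x"
    using assms(1) unfolding Cred_def closure_sequential by blast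
  obtain Y where Y: "\<And>n. Y n \<in> oper.span (range lreg)" "Y \<longlonglongrightarrow> y"
    using assms(2) unfolding Cred_def closure_sequential by blast
  have "\<And>n. X n + Y n \<in> oper.span (range lreg)"
    by (intro oper.span_add X Y)
  moreover have "(\<lambda>n. X n + Y n) \<longlonglongrightarrow> x + y"
    by (intro tendsto_add X Y)
  ultimately show ?thesis
    unfolding Cred_def closure_sequential by (intro exI[of _ "\<lambda>n. X n + Y n"]) simp
qed

lemma Cred_zero: "0 \<in> Cred"
  using span_lreg_subset_Cred oper.span_zero by blast

lemma Cred_scaleR: "x \<in> Cred \<Longrightarrow> r *\<^sub>R x \<in> Cred"
  using Cred_scale[of x "of_real r"] by (simp add: oper_scale_of_real)

lemma Cred_diff: "x \<in> Cred \<Longrightarrow> y \<in> Cred \<Longrightarrow> x - y \<in> Cred"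
  using Cred_add[of x "- y"] Cred_scaleR[of y "-1"] by simp

lemma Cred_id: "id_blinfun \<in> Cred"
  using lreg_in_Cred[of 0] by (simp add: lreg_zero)

lemma Cred_sum: "(\<And>i. i \<in> A \<Longrightarrow> f i \<in> Cred) \<Longrightarrow> sum f A \<in> Cred"
  by (induction A rule: infinite_finite_induct) (auto intro: Cred_zero Cred_add)

lemma Cred_has_sum:
  assumes "(f has_sum s) A" "\<And>i. i \<in> A \<Longrightarrow> f i \<in> Cred"
  shows "s \<in> Cred"
proof (rule Lim_in_closed_set[OF closed_Cred])
  show "(sum f \<longlongrightarrow> s) (finite_subsets_at_top A)"
    using assms(1) by (simp add: has_sum_def)
  show "\<forall>\<^sub>F F in finite_subsets_at_top A. sum f F \<in> Cred"
    using assms(2) by (intro eventually_finite_subsets_at_top_weakI Cred_sum) auto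
qed simp

lemma Cred_infsum: "(\<And>i. i \<in> A \<Longrightarrow> f i \<in> Cred) \<Longrightarrow> infsum f A \<in> Cred"
  by (cases "f summable_on A") (auto intro: Cred_has_sum has_sum_infsum Cred_zero simp: infsum_not_exists)

text \<open>
  Bounded operators are only real-linear by their type; complex linearity holds for the
  translations and survives linear combinations and limits.
\<close>
lemma Cred_apply_scale:
  assumes "x \<in> Cred"
  shows "blinfun_apply x (ell2_scale c f) = ell2_scale c (blinfun_apply x f)"
  using assms
proof (induction rule: Cred_closed_induct)
  case closed
  have "continuous_on UNIV (\<lambda>x. blinfun_apply x (ell2_scale c f))"
    by (intro continuous_intros)
  moreover have "continuous_on UNIV (\<lambda>x. ell2_scale c (blinfun_apply x f))"
    by (intro bounded_linear.continuous_on[OF bounded_linear_ell2_scale] continuous_intros)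
  ultimately show ?case by (rule closed_Collect_eq)
qed (simp_all add: blinfun.add_left oper_scale_apply lreg_apply ell2_translate_scale
    ell2_scale_scale ell2_scale_add mult.commute)

lemma Cred_compose:
  assumes "x \<in> Cred" "y \<in> Cred"
  shows "x o\<^sub>L y \<in> Cred"
  using assms(1)
proof (induction rule: Cred_closed_induct)
  case closed
  have "continuous_on UNIV (\<lambda>x. x o\<^sub>L y)"
    by (intro continuous_intros)
  from closed_vimage[OF closed_Cred this] show ?case
    by (simp add: vimage_def)
next
  case (lreg c g z)
  have "lreg g o\<^sub>L y \<in> Cred"
    using assms(2)
  proof (induction rule: Cred_closed_induct)
    case closed
    have "continuous_on UNIV (\<lambda>y. lreg g o\<^sub>L y)"
      by (intro continuous_intros)
    from closed_vimage[OF closed_Cred this] show ?case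
      by (simp add: vimage_def)
  next
    case (lreg d h w)
    have "lreg g o\<^sub>L (d *\<^sub>C lreg h) = d *\<^sub>C lreg (g + h)"
      by (intro blinfun_eqI) (simp add: oper_scale_apply lreg_apply ell2_translate_scale
          lreg_compose[symmetric])
    then show ?case
      using lreg by (simp add: bounded_bilinear.add_right[OF bounded_bilinear_blinfun_compose] Cred_add Cred_scale lreg_in_Cred)
  qed (simp add: Cred_zero)
  then show ?case
    using lreg by (simp add: bounded_bilinear.add_left[OF bounded_bilinear_blinfun_compose] compose_oper_scale_left Cred_add Cred_scale)
qed (simp add: Cred_zero)

section \<open>Adjoints\<close>

text \<open>
  Stated with the real inner product, whose algebraic and continuity laws are those of a real
  inner product space. For complex-linear operators this agrees with adjointness for
  the complex inner product.
\<close>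
definition is_adjoint :: "'g oper \<Rightarrow> 'g oper \<Rightarrow> bool" where
  "is_adjoint S T \<longleftrightarrow> (\<forall>f g. blinfun_apply S f \<bullet> g = f \<bullet> blinfun_apply T g)"

lemma is_adjointD: "is_adjoint S T \<Longrightarrow> blinfun_apply S f \<bullet> g = f \<bullet> blinfun_apply T g"
  by (simp add: is_adjoint_def)

lemma is_adjoint_sym: "is_adjoint S T \<Longrightarrow> is_adjoint T S"
  by (metis inner_commute is_adjoint_def)

lemma is_adjoint_unique: "is_adjoint S T \<Longrightarrow> is_adjoint S' T \<Longrightarrow> S = S'"
  by (intro blinfun_eqI) (metis is_adjoint_def vector_eq_rdot)

lemma is_adjoint_add: "is_adjoint S T \<Longrightarrow> is_adjoint S' T' \<Longrightarrow> is_adjoint (S + S') (T + T')"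
  by (simp add: is_adjoint_def blinfun.add_left inner_add_left inner_add_right)

lemma is_adjoint_diff: "is_adjoint S T \<Longrightarrow> is_adjoint S' T' \<Longrightarrow> is_adjoint (S - S') (T - T')"
  by (simp add: is_adjoint_def blinfun.diff_left inner_diff_left inner_diff_right)

lemma is_adjoint_scaleR: "is_adjoint S T \<Longrightarrow> is_adjoint (r *\<^sub>R S) (r *\<^sub>R T)"
  by (simp add: is_adjoint_def blinfun.scaleR_left)

lemma is_adjoint_compose: "is_adjoint S T \<Longrightarrow> is_adjoint S' T' \<Longrightarrow> is_adjoint (S o\<^sub>L S') (T' o\<^sub>L T)"
  by (simp add: is_adjoint_def)

lemma is_adjoint_id: "is_adjoint id_blinfun id_blinfun"
  by (simp add: is_adjoint_def)

lemma is_adjoint_norm_le: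
  assumes "is_adjoint S T"
  shows "norm S \<le> norm T"
proof (rule norm_blinfun_bound)
  fix f
  let ?n = "norm (blinfun_apply S f)"
  have "?n * ?n = f \<bullet> blinfun_apply T (blinfun_apply S f)"
    using is_adjointD[OF assms] by (metis power2_eq_square power2_norm_eq_inner)
  also have "\<dots> \<le> norm f * norm (blinfun_apply T (blinfun_apply S f))"
    by (rule norm_cauchy_schwarz)
  also have "\<dots> \<le> norm f * (norm T * ?n)"
    by (intro mult_left_mono norm_blinfun) simp
  finally have "?n * ?n \<le> (norm T * norm f) * ?n"
    by (simp add: algebra_simps)
  then show "?n \<le> norm T * norm f"
    by (cases "?n = 0") (auto simp: mult_le_cancel_right)
qed simp

lemma closed_is_adjoint_set:
  assumes "continuous_on UNIV S" "continuous_on UNIV T"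
  shows "closed {x. is_adjoint (S x) (T x)}"
  unfolding is_adjoint_def
  by (intro closed_Collect_all closed_Collect_eq continuous_intros
      continuous_on_compose2[OF assms(1)] continuous_on_compose2[OF assms(2)]) auto

text \<open>
  The adjoint of a translation is the inverse translation. Since taking adjoints does not increase
  the norm, the adjoints along a convergent sequence form a Cauchy sequence, and completeness
  supplies the adjoint of the limit.
\<close>
lemma Cred_adjoint_exists:
  assumes "x \<in> Cred"
  shows "\<exists>S\<in>Cred. is_adjoint S x"
  using assms
proof (induction rule: Cred_closed_induct)
  case closed
  have "\<exists>S\<in>Cred. is_adjoint S l"
    if x: "\<And>n. \<exists>S\<in>Cred. is_adjoint S (x n)" "x \<longlonglongrightarrow> l" for x l
  proof -
    obtain S where S: "\<And>n. S n \<in> Cred" "\<And>n. is_adjoint (S n) (x n)"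
      using x(1) by metis
    have "Cauchy S"
    proof (rule CauchyI)
      fix e :: real assume "e > 0"
      then obtain N where "\<forall>m\<ge>N. \<forall>n\<ge>N. norm (x m - x n) < e"
        using LIMSEQ_imp_Cauchy[OF x(2)] by (auto simp: Cauchy_iff)
      moreover have "norm (S m - S n) \<le> norm (x m - x n)" for m n
        by (intro is_adjoint_norm_le is_adjoint_diff S)
      ultimately show "\<exists>N. \<forall>m\<ge>N. \<forall>n\<ge>N. norm (S m - S n) < e"
        using le_less_trans by blast
    qed
    then obtain L where L: "S \<longlonglongrightarrow> L"
      using Cauchy_convergent convergent_def by blast
    have "is_adjoint L l"
      unfolding is_adjoint_def
    proof (intro allI)
      fix f g
      have "(\<lambda>n. blinfun_apply (S n) f \<bullet> g) \<longlonglongrightarrow> blinfun_apply L f \<bullet> g"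
        by (intro tendsto_intros L)
      moreover have "(\<lambda>n. f \<bullet> blinfun_apply (x n) g) \<longlonglongrightarrow> f \<bullet> blinfun_apply l g"
        by (intro tendsto_intros x)
      ultimately show "blinfun_apply L f \<bullet> g = f \<bullet> blinfun_apply l g"
        unfolding is_adjointD[OF S(2)] by (rule LIMSEQ_unique)
    qed
    moreover have "L \<in> Cred"
      using closed_sequentially[OF closed_Cred] S(1) L by blast
    ultimately show ?thesis by blast
  qed
  then show ?case
    by (auto simp: closed_sequential_limits)
next
  case zero
  show ?case by (rule bexI[of _ 0]) (simp_all add: is_adjoint_def Cred_zero)
next
  case (lreg c g y)
  then obtain S where "S \<in> Cred" "is_adjoint S y" by blast
  moreover have "is_adjoint (cnj c *\<^sub>C lreg (- g)) (c *\<^sub>C lreg g)"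
    by (simp add: is_adjoint_def oper_scale_apply lreg_apply ell2_scale_inner ell2_translate_inner
        ell2_translate_scale)
  ultimately have "is_adjoint (cnj c *\<^sub>C lreg (- g) + S) (c *\<^sub>C lreg g + y)"
    by (intro is_adjoint_add)
  moreover have "cnj c *\<^sub>C lreg (- g) + S \<in> Cred"
    using \<open>S \<in> Cred\<close> by (intro Cred_add Cred_scale lreg_in_Cred)
  ultimately show ?case by blast
qed

lemma oper_adj_eqI:
  assumes "T \<in> Cred" "is_adjoint S T"
  shows "oper_adj T = S"
  unfolding oper_adj_def
proof (rule the_equality)
  show "\<forall>f g. ell2_cinner (blinfun_apply S f) g = ell2_cinner f (blinfun_apply T g)"
    using assms(2) by (simp add: ell2_cinner_eq is_adjoint_def Cred_apply_scale[OF assms(1), symmetric])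
  show "S' = S"
    if "\<forall>f g. ell2_cinner (blinfun_apply S' f) g = ell2_cinner f (blinfun_apply T g)" for S'
    using that by (intro is_adjoint_unique[OF _ assms(2)]) (simp add: ell2_cinner_eq is_adjoint_def)
qed

lemma Cred_oper_adj:
  assumes "x \<in> Cred"
  shows "oper_adj x \<in> Cred" "is_adjoint (oper_adj x) x"
  using Cred_adjoint_exists[OF assms] oper_adj_eqI[OF assms] by auto

section \<open>Fourier coefficients\<close>

lemma bounded_linear_fourier: "bounded_linear (\<lambda>x. fourier x g)"
  unfolding fourier_def
  by (rule bounded_linear_compose[OF ell2_apply_bounded_linear blinfun.bounded_linear_left])

lemmas fourier_add = linear_add[OF bounded_linear.linear[OF bounded_linear_fourier]]
lemmas fourier_diff = linear_diff[OF bounded_linear.linear[OF bounded_linear_fourier]]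
lemmas fourier_zero = linear_0[OF bounded_linear.linear[OF bounded_linear_fourier]]
lemmas fourier_scaleR = linear_scale[OF bounded_linear.linear[OF bounded_linear_fourier]]

lemma fourier_scale: "fourier (c *\<^sub>C x) g = c * fourier x g"
  by (simp add: fourier_def oper_scale_apply ell2_scale.rep_eq)

lemma fourier_lreg: "fourier (lreg g) h = (if h = g then 1 else 0)"
proof -
  have "- g + h = 0 \<longleftrightarrow> h = g"
    by (metis add.right_inverse add_left_imp_eq left_minus)
  then show ?thesis
    by (simp add: fourier_def lreg_apply ell2_translate.rep_eq ell2_delta.rep_eq)
qed

text \<open>
  Elements of the algebra commute with right translations, so the Fourier coefficients, which
  are the matrix column at the identity, determine every other column.
\<close>
lemma Cred_apply_delta:
  assumes "x \<in> Cred"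
  shows "ell2_apply (blinfun_apply x (ell2_delta h)) k = fourier x (k - h)"
  using assms
proof (induction rule: Cred_closed_induct)
  case closed
  have "continuous_on UNIV (\<lambda>x. ell2_apply (blinfun_apply x (ell2_delta h)) k)"
    by (intro bounded_linear.continuous_on[OF ell2_apply_bounded_linear] continuous_intros)
  moreover have "continuous_on UNIV (\<lambda>x. fourier x (k - h))"
    by (rule linear_continuous_on[OF bounded_linear_fourier])
  ultimately show ?case by (rule closed_Collect_eq)
next
  case (lreg c g y)
  have "- g + k = h \<longleftrightarrow> k - h = g"
    by (metis add_diff_cancel add_minus_cancel diff_add_cancel minus_add_cancel)
  then show ?case
    using lreg by (auto simp: blinfun.add_left oper_scale_apply lreg_apply fourier_add
        fourier_scale fourier_lreg plus_ell2.rep_eq ell2_scale.rep_eq ell2_translate.rep_eq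
        ell2_delta.rep_eq)
qed (simp add: fourier_zero zero_ell2.rep_eq)

text \<open>
  All matrix coefficients vanish by the previous lemma. The adjoint therefore kills
  every scalar multiple of a basis vector, and moving the operator to the other side of the
  inner product shows that \<open>x f\<close> is orthogonal to all of these.
\<close>
lemma Cred_eq_0_if_fourier_eq_0:
  assumes x: "x \<in> Cred" and "\<And>g. fourier x g = 0"
  shows "x = 0"
proof (intro blinfun_eqI, simp)
  fix f
  have delta: "blinfun_apply x (ell2_delta h) = 0" for h
    by (rule ell2_eqI) (simp add: Cred_apply_delta[OF x] assms zero_ell2.rep_eq)
  note adj = is_adjointD[OF is_adjoint_sym[OF Cred_oper_adj(2)[OF x]]]
  have "blinfun_apply (oper_adj x) (ell2_scale c (ell2_delta k)) = 0" for c k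
  proof (rule ell2_eq_0_if_orthogonal_deltas)
    fix d h
    show "blinfun_apply (oper_adj x) (ell2_scale c (ell2_delta k)) \<bullet> ell2_scale d (ell2_delta h) = 0"
      by (metis Cred_apply_scale[OF x] Cred_oper_adj(2)[OF x] delta ell2_scale_zero inner_zero_right
          is_adjointD)
  qed
  then show "blinfun_apply x f = 0"
    by (intro ell2_eq_0_if_orthogonal_deltas) (simp add: adj)
qed

lemma Cred_eqI_fourier:
  assumes "x \<in> Cred" "y \<in> Cred" "\<And>g. fourier x g = fourier y g"
  shows "x = y"
  using Cred_eq_0_if_fourier_eq_0[of "x - y"] assms by (simp add: Cred_diff fourier_diff)

text \<open>
  Each Fourier coefficient is a bounded functional, so it may be applied termwise to a
  norm-convergent series, and only one term survives.
\<close>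
lemma fourier_has_sum:
  assumes "((\<lambda>g. a g *\<^sub>C lreg g) has_sum s) A"
  shows "fourier s h = (if h \<in> A then a h else 0)"
proof -
  have "((\<lambda>g. fourier (a g *\<^sub>C lreg g) h) has_sum fourier s h) A"
    by (rule has_sum_bounded_linear[OF bounded_linear_fourier assms])
  moreover have "((\<lambda>g. fourier (a g *\<^sub>C lreg g) h) has_sum (if h \<in> A then a h else 0)) A"
  proof (rule has_sum_cong_neutral[THEN iffD1])
    show "((\<lambda>g. if h \<in> A then a h else 0) has_sum (if h \<in> A then a h else 0)) (A \<inter> {h})"
      by (cases "h \<in> A") (auto intro: has_sum_finiteI)
  qed (auto simp: fourier_scale fourier_lreg)
  ultimately show ?thesis by (rule has_sum_unique)
qed

text \<open>
  The sum of the Fourier series has the same coefficients as \<open>x\<close>, so it can only be \<open>x\<close>.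
\<close>
lemma Cred_has_sum_fourier:
  assumes "x \<in> Cred" "(\<lambda>g. fourier x g *\<^sub>C lreg g) summable_on UNIV"
  shows "((\<lambda>g. fourier x g *\<^sub>C lreg g) has_sum x) UNIV"
proof -
  have "infsum (\<lambda>g. fourier x g *\<^sub>C lreg g) UNIV = x"
    using fourier_has_sum[OF has_sum_infsum[OF assms(2)]]
    by (intro Cred_eqI_fourier assms Cred_infsum Cred_scale lreg_in_Cred) simp
  then show ?thesis using has_sum_infsum[OF assms(2)] by simp
qed

section \<open>Automatic continuity\<close>

text \<open>
  The square root of \<open>1 - a\<close> is obtained as a fixed point: with
  \<open>y = 1 - w\<close> the equation \<open>y\<^sup>2 = 1 - a\<close> becomes \<open>w = (a + w\<^sup>2) / 2\<close>, and the right-hand side is a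
  contraction of the ball of radius \<open>1 / 2\<close>. The iteration preserves self-adjointness and
  membership in the closed algebra, so its fixed point has both.
\<close>
lemma self_adjoint_contraction_sqrt:
  fixes a :: "'g::group_add oper"
  assumes a: "a \<in> Cred" "is_adjoint a a" "norm a \<le> 1 / 4"
  obtains y where "y \<in> Cred" "is_adjoint y y" "y o\<^sub>L y = id_blinfun - a"
proof -
  define W :: "'g oper set" where "W = {w \<in> Cred. is_adjoint w w \<and> norm w \<le> 1 / 2}"
  define \<phi> where "\<phi> w = (1 / 2) *\<^sub>R (a + (w o\<^sub>L w))" for w
  have "W = Cred \<inter> {w. is_adjoint w w} \<inter> cball 0 (1 / 2)"
    by (auto simp: W_def)
  moreover have "closed {w :: 'g oper. is_adjoint w w}"
    by (intro closed_is_adjoint_set continuous_intros)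
  ultimately have "closed W"
    using closed_Cred by (auto intro!: closed_Int)
  have "\<exists>!w\<in>W. \<phi> w = w"
  proof (rule Banach_fix[where c = "1 / 2"])
    show "complete W"
      using \<open>closed W\<close> by (simp add: complete_eq_closed)
    show "W \<noteq> {}"
      by (auto simp: W_def is_adjoint_def Cred_zero intro!: exI[of _ 0])
    show "\<phi> ` W \<subseteq> W"
    proof (rule image_subsetI)
      fix w assume w: "w \<in> W"
      have "norm (w o\<^sub>L w) \<le> norm w * norm w"
        by (rule norm_blinfun_compose)
      also have "\<dots> \<le> (1 / 2) * (1 / 2)"
        using w by (intro mult_mono) (auto simp: W_def)
      finally have "norm (a + (w o\<^sub>L w)) \<le> 1"
        using norm_triangle_ineq[of a "w o\<^sub>L w"] a(3) by simp
      then show "\<phi> w \<in> W"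
        using w a(1,2) by (auto simp: W_def \<phi>_def intro!: Cred_scaleR Cred_add Cred_compose
            is_adjoint_scaleR is_adjoint_add is_adjoint_compose)
    qed
    show "dist (\<phi> w) (\<phi> u) \<le> 1 / 2 * dist w u" if wu: "w \<in> W" "u \<in> W" for w u
    proof -
      have "(w o\<^sub>L w) - (u o\<^sub>L u) = (w o\<^sub>L (w - u)) + ((w - u) o\<^sub>L u)"
        by (intro blinfun_eqI) (simp add: blinfun.diff_left blinfun.diff_right blinfun.add_left)
      then have "norm ((w o\<^sub>L w) - (u o\<^sub>L u)) \<le> norm w * norm (w - u) + norm (w - u) * norm u"
        by (metis norm_triangle_mono norm_blinfun_compose)
      also have "\<dots> \<le> 1 / 2 * norm (w - u) + norm (w - u) * (1 / 2)"
        using wu by (intro add_mono mult_mono) (auto simp: W_def)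
      finally have "norm ((w o\<^sub>L w) - (u o\<^sub>L u)) \<le> norm (w - u)" by simp
      moreover have "\<phi> w - \<phi> u = (1 / 2) *\<^sub>R ((w o\<^sub>L w) - (u o\<^sub>L u))"
        by (simp add: \<phi>_def algebra_simps)
      ultimately show ?thesis
        by (simp add: dist_norm)
    qed
  qed auto
  then obtain w where w: "w \<in> W" "\<phi> w = w" by blast
  have "a + (w o\<^sub>L w) = 2 *\<^sub>R \<phi> w"
    by (simp add: \<phi>_def)
  then have "a + (w o\<^sub>L w) = 2 *\<^sub>R w"
    using w(2) by simp
  then have w2: "blinfun_apply a f + blinfun_apply w (blinfun_apply w f) = 2 *\<^sub>R blinfun_apply w f" for f
    by (metis blinfun.add_left blinfun.scaleR_left blinfun_apply_blinfun_compose)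
  show ?thesis
  proof
    show "id_blinfun - w \<in> Cred" "is_adjoint (id_blinfun - w) (id_blinfun - w)"
      using w(1) by (auto simp: W_def intro: Cred_diff Cred_id is_adjoint_diff is_adjoint_id)
    show "(id_blinfun - w) o\<^sub>L (id_blinfun - w) = id_blinfun - a"
    proof (intro blinfun_eqI)
      fix f
      show "blinfun_apply ((id_blinfun - w) o\<^sub>L (id_blinfun - w)) f = blinfun_apply (id_blinfun - a) f"
        using w2[of f] by (simp add: blinfun.diff_left blinfun.diff_right scaleR_2 algebra_simps)
    qed
  qed
qed

context
  fixes \<Phi> :: "'g::group_add oper \<Rightarrow> 'g oper"
  assumes aut: "Cred_star_automorphism \<Phi>"
begin

lemma aut_Cred: "x \<in> Cred \<Longrightarrow> \<Phi> x \<in> Cred"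
  using aut by (auto simp: Cred_star_automorphism_def bij_betw_def)

lemma aut_add: "x \<in> Cred \<Longrightarrow> y \<in> Cred \<Longrightarrow> \<Phi> (x + y) = \<Phi> x + \<Phi> y"
  using aut by (auto simp: Cred_star_automorphism_def)

lemma aut_scale: "x \<in> Cred \<Longrightarrow> \<Phi> (c *\<^sub>C x) = c *\<^sub>C \<Phi> x"
  using aut by (auto simp: Cred_star_automorphism_def)

lemma aut_compose: "x \<in> Cred \<Longrightarrow> y \<in> Cred \<Longrightarrow> \<Phi> (x o\<^sub>L y) = \<Phi> x o\<^sub>L \<Phi> y"
  using aut by (auto simp: Cred_star_automorphism_def)

lemma aut_adj: "x \<in> Cred \<Longrightarrow> \<Phi> (oper_adj x) = oper_adj (\<Phi> x)"
  using aut by (auto simp: Cred_star_automorphism_def)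

lemma aut_scaleR: "x \<in> Cred \<Longrightarrow> \<Phi> (r *\<^sub>R x) = r *\<^sub>R \<Phi> x"
  using aut_scale[of x "of_real r"] by (simp add: oper_scale_of_real)

lemma aut_diff:
  assumes "x \<in> Cred" "y \<in> Cred"
  shows "\<Phi> (x - y) = \<Phi> x - \<Phi> y"
  using aut_add[OF assms(1) Cred_scaleR[OF assms(2), of "-1"]] aut_scaleR[OF assms(2), of "-1"]
  by simp

lemma aut_zero: "\<Phi> 0 = 0"
  using aut_diff[OF Cred_zero Cred_zero] by simp

lemma aut_sum: "(\<And>i. i \<in> A \<Longrightarrow> f i \<in> Cred) \<Longrightarrow> \<Phi> (sum f A) = (\<Sum>i\<in>A. \<Phi> (f i))"
  by (induction A rule: infinite_finite_induct) (simp_all add: aut_zero aut_add Cred_sum)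

text \<open>
  With \<open>1 - x\<^sup>* x = y\<^sup>2\<close> and \<open>y\<close> self-adjoint, a unital *-homomorphism \<open>\<Phi>\<close> gives
  \<open>1 - \<Phi>(x)\<^sup>* \<Phi>(x) = \<Phi>(y)\<^sup>2\<close>, hence \<open>\<parallel>\<Phi>(x) f\<parallel>\<^sup>2 = \<parallel>f\<parallel>\<^sup>2 - \<parallel>\<Phi>(y) f\<parallel>\<^sup>2\<close>.
  This is where an algebraic hypothesis on \<open>\<Phi>\<close> produces a bound on the norm.
\<close>
lemma aut_norm_le_1:
  assumes one: "\<Phi> id_blinfun = id_blinfun" and x: "x \<in> Cred" "norm x \<le> 1 / 2"
  shows "norm (\<Phi> x) \<le> 1"
proof (rule norm_blinfun_bound)
  fix f
  define a where "a = oper_adj x o\<^sub>L x"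
  note xs = Cred_oper_adj[OF x(1)]
  have "norm a \<le> norm (oper_adj x) * norm x"
    unfolding a_def by (rule norm_blinfun_compose)
  also have "\<dots> \<le> (1 / 2) * (1 / 2)"
    using x(2) is_adjoint_norm_le[OF xs(2)] by (intro mult_mono) auto
  finally have a: "a \<in> Cred" "is_adjoint a a" "norm a \<le> 1 / 4"
    using xs x(1) is_adjoint_compose[OF xs(2) is_adjoint_sym[OF xs(2)]]
    by (auto simp: a_def intro: Cred_compose)
  then obtain y where y: "y \<in> Cred" "is_adjoint y y" "y o\<^sub>L y = id_blinfun - a"
    by (rule self_adjoint_contraction_sqrt)
  have adj_y: "is_adjoint (\<Phi> y) (\<Phi> y)"
    using Cred_oper_adj(2)[OF aut_Cred[OF y(1)]] aut_adj[OF y(1)] oper_adj_eqI[OF y(1,2)] by simp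
  have adj_x: "is_adjoint (\<Phi> (oper_adj x)) (\<Phi> x)"
    using Cred_oper_adj(2)[OF aut_Cred[OF x(1)]] aut_adj[OF x(1)] by simp
  have "\<Phi> (oper_adj x) o\<^sub>L \<Phi> x = \<Phi> a"
    using aut_compose[OF xs(1) x(1)] by (simp add: a_def)
  moreover have "\<Phi> a = id_blinfun - (\<Phi> y o\<^sub>L \<Phi> y)"
    using aut_diff[OF Cred_id Cred_compose[OF y(1) y(1)]] aut_compose[OF y(1) y(1)] one y(3) by simp
  ultimately have "blinfun_apply (\<Phi> (oper_adj x)) (blinfun_apply (\<Phi> x) f)
      = f - blinfun_apply (\<Phi> y) (blinfun_apply (\<Phi> y) f)"
    by (metis blinfun.diff_left blinfun_apply_blinfun_compose id_blinfun.rep_eq id_apply)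
  then have "(norm (blinfun_apply (\<Phi> x) f))\<^sup>2 = (norm f)\<^sup>2 - (norm (blinfun_apply (\<Phi> y) f))\<^sup>2"
    using is_adjointD[OF adj_x, of "blinfun_apply (\<Phi> x) f" f]
      is_adjointD[OF adj_y, of "blinfun_apply (\<Phi> y) f" f]
    by (simp add: power2_norm_eq_inner inner_diff_left)
  then have "(norm (blinfun_apply (\<Phi> x) f))\<^sup>2 \<le> (norm f)\<^sup>2" by simp
  then show "norm (blinfun_apply (\<Phi> x) f) \<le> 1 * norm f"
    by (simp add: abs_le_square_iff[symmetric])
qed simp

text \<open>
  Scaling to norm \<open>1 / 2\<close> gives a Lipschitz bound, whose constant 2 reflects that the square
  root above is taken for \<open>\<parallel>x\<parallel> \<le> 1 / 2\<close>. The constant is the same for all \<open>\<Phi>\<close>, hence for all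
  times of the modulation group.
\<close>
lemma aut_norm_le:
  assumes one: "\<Phi> id_blinfun = id_blinfun" and x: "x \<in> Cred"
  shows "norm (\<Phi> x) \<le> 2 * norm x"
proof (cases "x = 0")
  case False
  define r where "r = 1 / (2 * norm x)"
  have "norm (\<Phi> (r *\<^sub>R x)) \<le> 1"
    using False by (intro aut_norm_le_1 one Cred_scaleR x) (simp add: r_def)
  then show ?thesis
    using False by (simp add: aut_scaleR x r_def field_simps)
qed (simp add: aut_zero)

end

section \<open>The modulation group and its generator\<close>

lemma norm_add3_le:
  fixes x y z :: "'a::real_normed_vector"
  shows "norm (x + y + z) \<le> norm x + norm y + norm z"
  using norm_triangle_ineq[of "x + y" z] norm_triangle_ineq[of x y] by simp

lemma Fsmooth_summable:
  assumes "x \<in> Fsmooth n b" "k \<le> n"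
  shows "(\<lambda>g. (of_real (b g ^ k) * fourier x g) *\<^sub>C lreg g) summable_on UNIV"
    and "(\<lambda>g. (of_real (inverse (b g ^ k)) * fourier x g) *\<^sub>C lreg g) summable_on (- hom_ker b)"
  using assms by (simp_all add: Fsmooth_def)

lemma bounded_linear_oper_scale_left: "bounded_linear (\<lambda>c. c *\<^sub>C T)"
proof (rule bounded_linear_intro[where K = "norm T"])
  fix c
  have "norm (blinfun_apply (c *\<^sub>C T) f) \<le> (cmod c * norm T) * norm f" for f
    using mult_left_mono[OF norm_blinfun[of T f], of "cmod c"]
    by (simp add: oper_scale_apply norm_ell2_scale algebra_simps)
  then show "norm (c *\<^sub>C T) \<le> cmod c * norm T"
    by (intro norm_blinfun_bound) auto
qed (auto intro!: blinfun_eqI ell2_eqI simp: oper_scale_apply blinfun.add_left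
    blinfun.scaleR_left ell2_scale.rep_eq plus_ell2.rep_eq scaleR_ell2.rep_eq algebra_simps)

context
  fixes b :: "'g::group_add \<Rightarrow> real" and M :: "real \<Rightarrow> 'g oper \<Rightarrow> 'g oper"
  assumes M: "modulation_group b M" and b0: "b 0 = 0"
begin

lemma modulation_aut: "Cred_star_automorphism (M t)"
  using M by (simp add: modulation_group_def)

lemma modulation_zero: "x \<in> Cred \<Longrightarrow> M 0 x = x"
  using M by (simp add: modulation_group_def)

lemma modulation_lreg: "M t (lreg g) = exp (\<i> * t * b g) *\<^sub>C lreg g"
  using M by (simp add: modulation_group_def)

lemma modulation_id: "M t id_blinfun = id_blinfun"
  using modulation_lreg[of t 0] by (simp add: b0 lreg_zero)

lemma modulation_norm_diff:
  assumes "x \<in> Cred" "y \<in> Cred"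
  shows "norm (M t x - M t y) \<le> 2 * norm (x - y)"
  using aut_norm_le[OF modulation_aut modulation_id Cred_diff[OF assms]]
  by (simp add: aut_diff[OF modulation_aut assms])

lemma continuous_on_modulation: "continuous_on Cred (M t)"
proof (rule continuous_on_iff[THEN iffD2], intro ballI allI impI)
  fix x e assume x: "x \<in> (Cred :: 'g oper set)" and e: "(0 :: real) < e"
  have "dist (M t x') (M t x) < e" if "x' \<in> Cred" "dist x' x < e / 2" for x'
    using modulation_norm_diff[OF that(1) x, of t] that(2) by (simp add: dist_norm)
  with e show "\<exists>d>0. \<forall>x'\<in>Cred. dist x' x < d \<longrightarrow> dist (M t x') (M t x) < e"
    by (intro exI[of _ "e / 2"]) simp
qed

text \<open>
  The formula is immediate on linear combinations of translations; both sides are continuous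
  in \<open>x\<close> because automorphisms of the algebra are bounded. The induction carries membership in
  the algebra along, as \<open>M t\<close> is specified only there.
\<close>
lemma fourier_modulation:
  assumes "x \<in> Cred"
  shows "fourier (M t x) g = exp (\<i> * t * b g) * fourier x g"
proof -
  have "x \<in> Cred \<and> fourier (M t x) g - exp (\<i> * t * b g) * fourier x g = 0"
    using assms
  proof (induction rule: Cred_closed_induct)
    case closed
    have "continuous_on Cred (\<lambda>x. fourier (M t x) g - exp (\<i> * t * b g) * fourier x g)"
      by (intro continuous_intros bounded_linear.continuous_on[OF bounded_linear_fourier]
          continuous_on_modulation)
    then show ?case
      by (rule continuous_closed_preimage_constant) (rule closed_Cred)
  next
    case (lreg c h y)
    have "M t (c *\<^sub>C lreg h + y) = c *\<^sub>C (exp (\<i> * t * b h) *\<^sub>C lreg h) + M t y"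
      using lreg by (simp add: aut_add[OF modulation_aut] aut_scale[OF modulation_aut]
          Cred_scale lreg_in_Cred modulation_lreg)
    then show ?case
      using lreg by (simp add: Cred_add Cred_scale lreg_in_Cred fourier_add fourier_scale
          fourier_lreg algebra_simps)
  qed (simp add: Cred_zero aut_zero[OF modulation_aut] fourier_zero)
  then show ?thesis by simp
qed

lemma modulation_sum:
  "M s (\<Sum>g\<in>F. a g *\<^sub>C lreg g) = (\<Sum>g\<in>F. (exp (\<i> * s * b g) * a g) *\<^sub>C lreg g)"
  by (subst aut_sum[OF modulation_aut])
    (auto intro!: sum.cong simp: Cred_scale lreg_in_Cred aut_scale[OF modulation_aut]
      modulation_lreg mult.commute)

lemma modulation_sum_has_vector_derivative:
  "((\<lambda>s. M s (\<Sum>g\<in>F. a g *\<^sub>C lreg g)) has_vector_derivative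
     M s (\<Sum>g\<in>F. (\<i> * b g * a g) *\<^sub>C lreg g)) (at s within S)"
  unfolding modulation_sum
proof (rule has_vector_derivative_sum)
  fix g
  have "((\<lambda>z. exp (\<i> * z * b g) * a g) has_field_derivative
      exp (\<i> * of_real s * b g) * (\<i> * b g * a g)) (at (of_real s))"
    by (auto intro!: derivative_eq_intros)
  then have "((\<lambda>s. exp (\<i> * of_real s * b g) * a g) has_vector_derivative
      exp (\<i> * s * b g) * (\<i> * b g * a g)) (at s within S)"
    by (rule has_vector_derivative_real_field)
  then show "((\<lambda>s. (exp (\<i> * s * b g) * a g) *\<^sub>C lreg g) has_vector_derivative
      (exp (\<i> * s * b g) * (\<i> * b g * a g)) *\<^sub>C lreg g) (at s within S)"
    by (rule bounded_linear.has_vector_derivative[OF bounded_linear_oper_scale_left])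
qed

text \<open>
  Strong continuity at time 0: explicit on linear combinations of translations, and preserved
  under limits because the automorphisms are uniformly bounded.
\<close>
lemma modulation_tendsto:
  assumes "x \<in> Cred"
  shows "((\<lambda>s. M s x) \<longlongrightarrow> x) (at 0)"
proof -
  have "x \<in> Cred \<and> ((\<lambda>s. M s x) \<longlongrightarrow> x) (at 0)"
    using assms
  proof (induction rule: Cred_closed_induct)
    case closed
    have "l \<in> Cred \<and> ((\<lambda>s. M s l) \<longlongrightarrow> l) (at 0)"
      if X: "\<And>n. X n \<in> Cred" "\<And>n. ((\<lambda>s. M s (X n)) \<longlongrightarrow> X n) (at 0)" "X \<longlonglongrightarrow> l" for X l
    proof (rule conjI)
      show l: "l \<in> Cred"
        using closed_sequentially[OF closed_Cred X(1,3)] .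
      show "((\<lambda>s. M s l) \<longlongrightarrow> l) (at 0)"
      proof (rule tendstoI)
        fix e :: real assume e: "e > 0"
        then have "\<forall>\<^sub>F n in sequentially. dist (X n) l < e / 4"
          by (intro tendstoD X) simp
        then obtain n where n: "norm (X n - l) < e / 4"
          using eventually_happens'[OF sequentially_bot] by (auto simp: dist_norm)
        have "\<forall>\<^sub>F s in at 0. dist (M s (X n)) (X n) < e / 4"
          using e by (intro tendstoD X) simp
        then show "\<forall>\<^sub>F s in at 0. dist (M s l) l < e"
        proof eventually_elim
          case (elim s)
          have "M s l - l = (M s l - M s (X n)) + (M s (X n) - X n) + (X n - l)" by simp
          then have "norm (M s l - l) \<le> 2 * norm (l - X n) + norm (M s (X n) - X n) + norm (X n - l)"
            using norm_add3_le[of "M s l - M s (X n)" "M s (X n) - X n" "X n - l"]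
              modulation_norm_diff[OF l X(1), of s n] by simp
          then show ?case
            using elim n by (simp add: dist_norm norm_minus_commute)
        qed
      qed
    qed
    then show ?case
      unfolding closed_sequential_limits mem_Collect_eq by blast
  next
    case (lreg c g y)
    have "((\<lambda>s. exp (\<i> * of_real s * b g) * c) \<longlongrightarrow> exp (\<i> * of_real 0 * b g) * c) (at (0 :: real))"
      by (intro tendsto_intros)
    from bounded_linear.tendsto[OF bounded_linear_oper_scale_left this, of "lreg g"]
    have "((\<lambda>s. (exp (\<i> * of_real s * b g) * c) *\<^sub>C lreg g + M s y) \<longlongrightarrow> c *\<^sub>C lreg g + y) (at 0)"
      using lreg by (intro tendsto_add) simp_all
    moreover have "M s (c *\<^sub>C lreg g + y) = (exp (\<i> * s * b g) * c) *\<^sub>C lreg g + M s y" for s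
      using lreg by (simp add: aut_add[OF modulation_aut] aut_scale[OF modulation_aut]
          Cred_scale lreg_in_Cred modulation_lreg mult.commute)
    ultimately show ?case
      using lreg by (simp add: Cred_add Cred_scale lreg_in_Cred)
  qed (simp add: Cred_zero aut_zero[OF modulation_aut])
  then show ?thesis by simp
qed

text \<open>
  This is the closedness of the generator, combined with its explicit form on finite sums. For
  a finite partial sum \<open>p\<close> of \<open>x\<close> with termwise derivative \<open>q\<close>, the derivative of \<open>M s p\<close> is
  \<open>M s q\<close>, so the mean value inequality bounds \<open>M t p - p - t q\<close> by \<open>\<bar>t\<bar>\<close> times the oscillation
  of \<open>M s q\<close> on the segment. That oscillation is controlled by the oscillation of \<open>M s y\<close> and by
  \<open>q - y\<close>; the latter disappears as the partial sums grow, for fixed \<open>t\<close>.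
\<close>
lemma generator_tendsto:
  assumes x: "((\<lambda>g. a g *\<^sub>C lreg g) has_sum x) UNIV"
    and y: "((\<lambda>g. (\<i> * b g * a g) *\<^sub>C lreg g) has_sum y) UNIV"
  shows "((\<lambda>t. (M t x - x) /\<^sub>R t) \<longlongrightarrow> y) (at 0)"
proof -
  define p where "p F = (\<Sum>g\<in>F. a g *\<^sub>C lreg g)" for F :: "'g set"
  define q where "q F = (\<Sum>g\<in>F. (\<i> * b g * a g) *\<^sub>C lreg g)" for F :: "'g set"
  have Cred: "x \<in> Cred" "y \<in> Cred" "p F \<in> Cred" "q F \<in> Cred" for F
    by (auto simp: p_def q_def intro!: Cred_has_sum[OF x] Cred_has_sum[OF y] Cred_sum Cred_scale lreg_in_Cred)
  have p: "(p \<longlongrightarrow> x) (finite_subsets_at_top UNIV)" and q: "(q \<longlongrightarrow> y) (finite_subsets_at_top UNIV)"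
    using x y by (simp_all add: has_sum_def p_def[abs_def] q_def[abs_def])
  show ?thesis
  proof (rule tendstoI)
    fix e :: real assume "e > 0"
    then have "\<forall>\<^sub>F s in at 0. dist (M s y) y < e / 2"
      by (intro tendstoD modulation_tendsto Cred) simp
    then obtain d where d: "d > 0" "\<And>s. s \<noteq> 0 \<Longrightarrow> \<bar>s\<bar> < d \<Longrightarrow> norm (M s y - y) < e / 2"
      by (auto simp: eventually_at dist_norm)
    \<comment> \<open>For fixed t the estimate is the limit of those for the finite partial sums.\<close>
    have bound: "norm (M t x - x - t *\<^sub>R y) \<le> \<bar>t\<bar> * (e / 2)" if t: "\<bar>t\<bar> < d" for t
    proof -
      have small: "norm (M s y - y) \<le> e / 2" if "\<bar>s\<bar> < d" for s
        using d(2)[of s] that modulation_zero[OF Cred(2)] \<open>e > 0\<close> by (cases "s = 0") auto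
      have "norm (M t (p F) - p F - t *\<^sub>R q F) \<le> \<bar>t\<bar> * (3 * norm (q F - y) + e / 2)" for F
      proof -
        have "norm (M s (q F) - M 0 (q F)) \<le> 3 * norm (q F - y) + e / 2"
          if "s \<in> closed_segment 0 t" for s
        proof -
          have "\<bar>s\<bar> < d"
            using that t by (auto simp: closed_segment_eq_real_ivl split: if_splits)
          \<comment> \<open>Comparing with y makes the choice of d independent of F.\<close>
          have "M s (q F) - M 0 (q F) = (M s (q F) - M s y) + (M s y - y) + (y - q F)"
            by (simp add: modulation_zero[OF Cred(4)])
          then have "norm (M s (q F) - M 0 (q F)) \<le> 2 * norm (q F - y) + e / 2 + norm (y - q F)"
            using norm_add3_le[of "M s (q F) - M s y" "M s y - y" "y - q F"]
              modulation_norm_diff[OF Cred(4,2), of s F] small[OF \<open>\<bar>s\<bar> < d\<close>] by simp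
          then show ?thesis by (simp add: norm_minus_commute)
        qed
        then have "norm (M t (p F) - M 0 (p F) - (t - 0) *\<^sub>R M 0 (q F))
            \<le> norm (t - 0) * (3 * norm (q F - y) + e / 2)"
          unfolding p_def q_def
          by (intro vector_differentiable_bound_linearization[where S = "closed_segment 0 t"]
              modulation_sum_has_vector_derivative) auto
        then show ?thesis
          by (simp add: modulation_zero[OF Cred(3)] modulation_zero[OF Cred(4)])
      qed
      moreover have "((\<lambda>F. M t (p F)) \<longlongrightarrow> M t x) (finite_subsets_at_top UNIV)"
        using continuous_on_tendsto_compose[OF continuous_on_modulation p] Cred by auto
      then have "((\<lambda>F. norm (M t (p F) - p F - t *\<^sub>R q F)) \<longlongrightarrow> norm (M t x - x - t *\<^sub>R y))
          (finite_subsets_at_top UNIV)"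
        by (intro tendsto_intros p q)
      moreover have "((\<lambda>F. \<bar>t\<bar> * (3 * norm (q F - y) + e / 2)) \<longlongrightarrow> \<bar>t\<bar> * (3 * norm (y - y) + e / 2))
          (finite_subsets_at_top UNIV)"
        by (intro tendsto_intros q)
      ultimately have "norm (M t x - x - t *\<^sub>R y) \<le> \<bar>t\<bar> * (3 * norm (y - y) + e / 2)"
        by (intro tendsto_le[of "finite_subsets_at_top UNIV"]) (auto intro: always_eventually)
      then show ?thesis by simp
    qed
    have "dist ((M t x - x) /\<^sub>R t) y < e" if t: "t \<noteq> 0" "\<bar>t\<bar> < d" for t
    proof -
      have "(M t x - x) /\<^sub>R t - y = (M t x - x - t *\<^sub>R y) /\<^sub>R t"
        using t by (simp add: scaleR_diff_right)
      then have "norm ((M t x - x) /\<^sub>R t - y) = norm (M t x - x - t *\<^sub>R y) / \<bar>t\<bar>"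
        by (simp add: divide_inverse_commute)
      also have "\<dots> \<le> e / 2"
        using bound[OF t(2)] t(1) by (simp add: pos_divide_le_eq mult.commute)
      finally show ?thesis using \<open>e > 0\<close> by (simp add: dist_norm)
    qed
    then show "\<forall>\<^sub>F t in at 0. dist ((M t x - x) /\<^sub>R t) y < e"
      using d(1) by (auto simp: eventually_at)
  qed
qed

lemma gen_eq:
  assumes "((\<lambda>g. a g *\<^sub>C lreg g) has_sum x) UNIV"
    and "((\<lambda>g. (\<i> * b g * a g) *\<^sub>C lreg g) has_sum y) UNIV"
  shows "gen M x = y"
  unfolding gen_def by (rule tendsto_Lim[OF _ generator_tendsto[OF assms]]) simp

text \<open>
  Summability of the series with weights \<open>b\<close> and \<open>b\<^sup>2\<close> places \<open>x\<close>, and then its image, in the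
  domain of the generator, which multiplies the coefficients by \<open>\<i> b\<close> each time. Without this
  the limit in the definition of \<open>gen\<close> would be an unspecified value.
\<close>
lemma fourier_H_op:
  assumes "x \<in> Fsmooth 2 b"
  shows "fourier (H_op M x) g = (- (b g)\<^sup>2) *\<^sub>R fourier x g"
proof -
  have sum: "(\<lambda>g. (of_real (b g ^ k) * fourier x g) *\<^sub>C lreg g) summable_on UNIV" if "k \<le> 2" for k
    using assms that by (rule Fsmooth_summable)
  have "x \<in> Cred"
    using assms by (simp add: Fsmooth_def)
  then have x: "((\<lambda>g. fourier x g *\<^sub>C lreg g) has_sum x) UNIV"
    using sum[of 0] by (intro Cred_has_sum_fourier) auto
  have scaled: "(\<lambda>g. (c * (of_real (b g ^ k) * fourier x g)) *\<^sub>C lreg g) summable_on UNIV"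
    if "k \<le> 2" for k c
    using summable_on_bounded_linear[OF bounded_linear_oper_scale[of c] sum[OF that]] by simp
  obtain y where y: "((\<lambda>g. (\<i> * b g * fourier x g) *\<^sub>C lreg g) has_sum y) UNIV"
    using scaled[of 1 \<i>] by (auto simp: summable_on_def mult.assoc)
  obtain z where z: "((\<lambda>g. (\<i> * b g * (\<i> * b g * fourier x g)) *\<^sub>C lreg g) has_sum z) UNIV"
    using scaled[of 2 "- 1"] by (auto simp: summable_on_def power2_eq_square algebra_simps)
  have "H_op M x = z"
    using gen_eq[OF x y] gen_eq[OF y z] by (simp add: H_op_def)
  moreover have "fourier z g = (\<i> * \<i>) * (of_real (b g) * of_real (b g) * fourier x g)"
    using fourier_has_sum[OF z, of g] by (simp only: UNIV_I if_True mult_ac)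
  ultimately show ?thesis
    by (simp add: scaleR_conv_of_real power2_eq_square)
qed

end

section \<open>The scalar wave equation\<close>

lemma constant_from_right_limit:
  fixes h :: "real \<Rightarrow> 'a::real_normed_vector"
  assumes "\<And>t. t > 0 \<Longrightarrow> (h has_vector_derivative 0) (at t)"
    and "(h \<longlongrightarrow> l) (at_right 0)" and "t > 0"
  shows "h t = l"
proof -
  have "\<exists>c. \<forall>t\<in>{0<..}. h t = c"
    using assms(1) by (intro has_derivative_zero_constant)
      (auto simp: has_vector_derivative_def intro: has_derivative_at_withinI)
  then obtain c where c: "\<And>t. t > 0 \<Longrightarrow> h t = c" by auto
  then have "\<forall>\<^sub>F t in at_right 0. h t = c"
    by (auto simp: eventually_at_filter)
  then have "(h \<longlongrightarrow> c) (at_right 0)"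
    by (rule tendsto_eventually)
  then have "c = l"
    using assms(2) by (intro tendsto_unique[of "at_right 0"]) auto
  with c[OF assms(3)] show ?thesis by simp
qed

text \<open>
  For \<open>\<beta> \<noteq> 0\<close>, rotating the phase vector \<open>(f, f' / \<beta>)\<close> back by the angle \<open>\<beta> t\<close> gives two conserved
  quantities. Their values are read off at \<open>0\<close>, and rotating forward again recovers \<open>f\<close>. For
  \<open>\<beta> = 0\<close> the conserved quantities are \<open>f'\<close> and \<open>f - t f'\<close>.
\<close>
lemma oscillator_solution:
  fixes f f' :: "real \<Rightarrow> 'a::real_normed_vector" and \<beta> :: real
  assumes f: "\<And>t. t > 0 \<Longrightarrow> (f has_vector_derivative f' t) (at t)"
    and f': "\<And>t. t > 0 \<Longrightarrow> (f' has_vector_derivative (- \<beta>\<^sup>2) *\<^sub>R f t) (at t)"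
    and lim: "(f \<longlongrightarrow> a) (at_right 0)" "(f' \<longlongrightarrow> c) (at_right 0)"
    and t: "t > 0"
  shows "f t = (if \<beta> = 0 then a + t *\<^sub>R c
    else cos (\<beta> * t) *\<^sub>R a + (sin (\<beta> * t) / \<beta>) *\<^sub>R c)"
proof (cases "\<beta> = 0")
  case True
  have "f' t = c"
    using f' lim(2) t True by (intro constant_from_right_limit) auto
  moreover have "f t - t *\<^sub>R f' t = a"
  proof (rule constant_from_right_limit[OF _ _ t])
    show "((\<lambda>t. f t - t *\<^sub>R f' t) has_vector_derivative 0) (at t)" if "t > 0" for t
      using f[OF that] f'[OF that] True by (auto intro!: derivative_eq_intros)
    have "((\<lambda>t. f t - t *\<^sub>R f' t) \<longlongrightarrow> a - 0 *\<^sub>R c) (at_right 0)"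
      by (intro tendsto_intros lim)
    then show "((\<lambda>t. f t - t *\<^sub>R f' t) \<longlongrightarrow> a) (at_right 0)" by simp
  qed
  ultimately show ?thesis using True by (simp add: algebra_simps)
next
  case False
  let ?A = "\<lambda>t. cos (\<beta> * t) *\<^sub>R f t - (sin (\<beta> * t) / \<beta>) *\<^sub>R f' t"
  let ?B = "\<lambda>t. (\<beta> * sin (\<beta> * t)) *\<^sub>R f t + cos (\<beta> * t) *\<^sub>R f' t"
  have A: "?A t = a"
  proof (rule constant_from_right_limit[OF _ _ t])
    show "(?A has_vector_derivative 0) (at t)" if "t > 0" for t
      using False
      by (auto intro!: derivative_eq_intros f[OF that] f'[OF that] simp: power2_eq_square)
    have "(?A \<longlongrightarrow> cos (\<beta> * 0) *\<^sub>R a - (sin (\<beta> * 0) / \<beta>) *\<^sub>R c) (at_right 0)"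
      using False by (intro tendsto_intros lim) auto
    then show "(?A \<longlongrightarrow> a) (at_right 0)" by simp
  qed
  have B: "?B t = c"
  proof (rule constant_from_right_limit[OF _ _ t])
    show "(?B has_vector_derivative 0) (at t)" if "t > 0" for t
      by (auto intro!: derivative_eq_intros f[OF that] f'[OF that] simp: power2_eq_square)
        (simp add: mult_ac)
    have "(?B \<longlongrightarrow> (\<beta> * sin (\<beta> * 0)) *\<^sub>R a + cos (\<beta> * 0) *\<^sub>R c) (at_right 0)"
      by (intro tendsto_intros lim)
    then show "(?B \<longlongrightarrow> c) (at_right 0)" by simp
  qed
  have "f t = (cos (\<beta> * t) * cos (\<beta> * t)) *\<^sub>R f t + (sin (\<beta> * t) * sin (\<beta> * t)) *\<^sub>R f t"
    by (simp only: scaleR_add_left[symmetric] sin_cos_squared_add3 scaleR_one)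
  also have "\<dots> = cos (\<beta> * t) *\<^sub>R ?A t + (sin (\<beta> * t) / \<beta>) *\<^sub>R ?B t"
    using False by (simp add: algebra_simps)
  finally show ?thesis
    using False unfolding A B by simp
qed

theorem proposition4p4:
  fixes b :: "'g::group_add \<Rightarrow> real"
    and M :: "real \<Rightarrow> 'g oper \<Rightarrow> 'g oper"
    and x0 y0 :: "'g oper"
    and v :: "real \<Rightarrow> 'g oper"
  assumes "countable (UNIV :: 'g set)" and "infinite (UNIV :: 'g set)"
    and "\<And>g h. b (g + h) = b g + b h" and "\<exists>g. b g \<noteq> 0"
    and "modulation_group b M"
    and "x0 \<in> Fsmooth 2 b" and "y0 \<in> Fsmooth 3 b"
    and "wave_solution b M x0 y0 v"
  shows "\<forall>t\<ge>0. v t =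
           t *\<^sub>R S_op b y0
           + (1 / 2) *\<^sub>R (M t x0 + M (- t) x0)
           + (1 / (2 * \<i>)) *\<^sub>C (M t (T_op b y0) - M (- t) (T_op b y0))"
proof (intro allI impI)
  fix t :: real assume "t \<ge> 0"
  have b0: "b 0 = 0"
    using assms(3)[of 0 0] by simp
  note M = assms(5) b0
  note aut = modulation_aut[OF M]
  note wave = assms(8)[unfolded wave_solution_def]
  have v: "v 0 = x0" "\<And>t. t \<ge> 0 \<Longrightarrow> v t \<in> Cred" "\<And>t. t > 0 \<Longrightarrow> v t \<in> Fsmooth 2 b"
    using wave by simp_all
  obtain v' where v': "(\<forall>t>0. (v has_vector_derivative v' t) (at t)) \<and>
      (\<forall>t>0. (v' has_vector_derivative H_op M (v t)) (at t)) \<and>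
      ((\<lambda>t. norm (v t - x0)) \<longlongrightarrow> 0) (at_right 0) \<and>
      ((\<lambda>t. norm (v' t - y0)) \<longlongrightarrow> 0) (at_right 0)"
    using wave by (elim conjE exE) (rule that, intro conjI)
  have lim: "(v \<longlongrightarrow> x0) (at_right 0)" "(v' \<longlongrightarrow> y0) (at_right 0)"
    using v' by (simp_all only: tendsto_norm_zero_iff LIM_zero_iff)
  have x0: "x0 \<in> Cred"
    using assms(6) by (simp add: Fsmooth_def)
  have S: "S_op b y0 \<in> Cred" and T: "T_op b y0 \<in> Cred"
    by (auto simp: S_op_def T_op_def intro!: Cred_infsum Cred_scale lreg_in_Cred)
  have fourier_S: "fourier (S_op b y0) g = (if b g = 0 then fourier y0 g else 0)" for g
  proof -
    have "(\<lambda>g. fourier y0 g *\<^sub>C lreg g) summable_on UNIV"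
      using Fsmooth_summable(1)[OF assms(7), of 0] by simp
    then have "(\<lambda>g. fourier y0 g *\<^sub>C lreg g) summable_on hom_ker b"
      by (rule summable_on_subset_banach[OF _ subset_UNIV])
    from fourier_has_sum[OF has_sum_infsum[OF this]] show ?thesis
      by (simp add: S_op_def hom_ker_def)
  qed
  have fourier_T: "fourier (T_op b y0) g = (if b g = 0 then 0 else fourier y0 g / b g)" for g
  proof -
    have "(\<lambda>g. (of_real (inverse (b g)) * fourier y0 g) *\<^sub>C lreg g) summable_on (- hom_ker b)"
      using Fsmooth_summable(2)[OF assms(7), of 1] by simp
    from fourier_has_sum[OF has_sum_infsum[OF this]] show ?thesis
      by (simp add: T_op_def hom_ker_def field_simps)
  qed
  show "v t = t *\<^sub>R S_op b y0 + (1 / 2) *\<^sub>R (M t x0 + M (- t) x0)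
      + (1 / (2 * \<i>)) *\<^sub>C (M t (T_op b y0) - M (- t) (T_op b y0))" (is "v t = ?u")
  proof (rule Cred_eqI_fourier)
    show "v t \<in> Cred" by (rule v(2)[OF \<open>t \<ge> 0\<close>])
    show "?u \<in> Cred"
      by (intro Cred_add Cred_scaleR Cred_scale Cred_diff S aut_Cred[OF aut] x0 T)
  next
    fix g
    let ?\<beta> = "b g"
    \<comment> \<open>The exponentials of the modulation group combine to the cosine and sine of the oscillator;
      for b g = 0 the coefficient of T_op vanishes and that of S_op supplies the linear term.\<close>
    let ?E = "exp (\<i> * t * ?\<beta>)" and ?E' = "exp (- (\<i> * t * ?\<beta>))"
    have arg: "\<i> * t * ?\<beta> = \<i> * of_real (?\<beta> * t)"
      by (simp add: mult_ac)
    have trig: "(1 / 2) * (?E + ?E') = of_real (cos (?\<beta> * t))"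
      "(1 / (2 * \<i>)) * (?E - ?E') = of_real (sin (?\<beta> * t))"
      by (simp_all only: arg times_divide_eq_left mult_1_left cos_exp_eq[symmetric]
          sin_exp_eq[symmetric] cos_of_real sin_of_real)
    have minus: "\<i> * of_real (- t) * of_real ?\<beta> = - (\<i> * t * ?\<beta>)"
      by simp
    have "fourier ?u g = t *\<^sub>R fourier (S_op b y0) g
        + (1 / 2) *\<^sub>R (?E * fourier x0 g + ?E' * fourier x0 g)
        + (1 / (2 * \<i>)) * (?E * fourier (T_op b y0) g - ?E' * fourier (T_op b y0) g)"
      by (simp only: fourier_add fourier_diff fourier_scaleR fourier_scale
          fourier_modulation[OF M x0] fourier_modulation[OF M T] minus)
    also have "\<dots> = t *\<^sub>R fourier (S_op b y0) g + (1 / 2) * (?E + ?E') * fourier x0 g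
        + (1 / (2 * \<i>)) * (?E - ?E') * fourier (T_op b y0) g"
      by (simp add: scaleR_conv_of_real ring_distribs mult.assoc)
    finally have u: "fourier ?u g = (if ?\<beta> = 0 then fourier x0 g + t *\<^sub>R fourier y0 g
        else cos (?\<beta> * t) *\<^sub>R fourier x0 g + (sin (?\<beta> * t) / ?\<beta>) *\<^sub>R fourier y0 g)"
      unfolding trig by (simp add: fourier_S fourier_T scaleR_conv_of_real)
    show "fourier (v t) g = fourier ?u g"
    proof (cases "t = 0")
      case True
      then show ?thesis unfolding u by (simp add: v(1))
    next
      case False
      show ?thesis
        unfolding u
      proof (rule oscillator_solution)
        fix s :: real assume "s > 0"
        show "((\<lambda>t. fourier (v t) g) has_vector_derivative fourier (v' s) g) (at s)"
          using v' \<open>s > 0\<close>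
          by (intro bounded_linear.has_vector_derivative[OF bounded_linear_fourier]) simp
        have "((\<lambda>t. fourier (v' t) g) has_vector_derivative fourier (H_op M (v s)) g) (at s)"
          using v' \<open>s > 0\<close>
          by (intro bounded_linear.has_vector_derivative[OF bounded_linear_fourier]) simp
        then show "((\<lambda>t. fourier (v' t) g) has_vector_derivative (- ?\<beta>\<^sup>2) *\<^sub>R fourier (v s) g) (at s)"
          by (simp only: fourier_H_op[OF M v(3)[OF \<open>s > 0\<close>]])
      next
        show "((\<lambda>t. fourier (v t) g) \<longlongrightarrow> fourier x0 g) (at_right 0)"
          by (rule bounded_linear.tendsto[OF bounded_linear_fourier lim(1)])
        show "((\<lambda>t. fourier (v' t) g) \<longlongrightarrow> fourier y0 g) (at_right 0)"
          by (rule bounded_linear.tendsto[OF bounded_linear_fourier lim(2)])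
        show "t > 0" using False \<open>t \<ge> 0\<close> by simp
      qed
    qed
  qed
qed

end
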